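(* Let $2\leq k$, $n\geq 2k$, and let $(J(n,k),\mathcal{P})$ be an $S_n$-primitive decomposition. Then $\mathcal{P}$ is one of the following: (1) $\mathcal{P}_\cap$; (2) $\mathcal{P}_\cup$, with $n\neq 2k+2$; (3) $\mathcal{P}_\ominus$, with $(n,k)\neq(4,2)$; (4) $n=2k+2$ and $\mathcal{P}=\{Q_W\cup Q_{X\setminus W}\mid W$ a $(k+1)$-subset of $X\}$ (divisors $\cong 2K_{k+1}$); (5) $(n,k)=(4,2)$ and $\mathcal{P}$ consists of three $4$-cycles: for each partition $\{\pi_1,\pi_2\}$ of $X=\{1,2,3,4\}$ into two $2$-subsets, the part consisting of the edges of $J(4,2)$ between the four $2$-subsets other than $\pi_1,\pi_2$; (6) $(n,k)=(6,3)$ and $\mathcal{P}=\{P_\pi\}$, $\pi$ ranging over partitions of $X$ into three $2$-subsets, where $P_\pi=\{\{A,B\}\mid A,B$ adjacent, $A\ominus B\in\pi$, $A\cap B\in\pi\}$ (divisors $\cong 6K_2$).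
   Context: $X$ is an $n$-set, $J(n,k)$ has vertices the $k$-subsets of $X$, adjacent when they share $k-1$ points, and $S_n=\mathrm{Sym}(X)$ acts naturally. A decomposition is a partition of the edge set into at least two parts (divisors); it is $S_n$-primitive if $S_n$ preserves it and acts primitively (in particular transitively) on its parts. $\mathcal{P}_\cap=\{P_Y\}$, $Y$ ranging over $(k-1)$-subsets, $P_Y$ the complete subgraph on $k$-subsets containing $Y$. $\mathcal{P}_\cup=\{Q_W\}$, $W$ ranging over $(k+1)$-subsets, $Q_W$ the complete subgraph on $k$-subsets of $W$. $\mathcal{P}_\ominus=\{M_{\{a,b\}}\}$, $M_{\{a,b\}}=\{\{\{a\}\cup Y,\{b\}\cup Y\}\mid Y$ a $(k-1)$-subset of $X\setminus\{a,b\}\}$. $\ominus$ is symmetric difference. *)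

theory Defs
  imports
    "HOL-Algebra.Group_Action"
    "HOL-Library.Disjoint_Sets"
    "HOL-Library.Ramsey"
begin

text \<open>Graphs are represented by their edge sets, an edge being a two-element set of vertices.
  The vertices of \<open>J(n,k)\<close> are \<open>nsets X k\<close>, and \<open>nsets S 2\<close> is the edge set of the
  complete graph on the vertex set \<open>S\<close>.\<close>

definition johnson_edges :: "'a set \<Rightarrow> nat \<Rightarrow> 'a set set set" where
  "johnson_edges X k =
     {{A, B} | A B. A \<in> nsets X k \<and> B \<in> nsets X k \<and> A \<noteq> B \<and> card (A \<inter> B) = k - 1}"

definition decomposition :: "'v set set \<Rightarrow> 'v set set set \<Rightarrow> bool" where
  "decomposition E P \<longleftrightarrow> partition_on E P \<and> finite P \<and> 2 \<le> card P"

text \<open>A transitive action is primitive if the only invariant partitions of the set acted on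
  are the one with a single part and the one into singletons.\<close>

definition primitive_action ::
    "('g, 'm) monoid_scheme \<Rightarrow> 'b set \<Rightarrow> ('g \<Rightarrow> 'b \<Rightarrow> 'b) \<Rightarrow> bool" where
  "primitive_action G E \<phi> \<longleftrightarrow>
     transitive_action G E \<phi> \<and>
     (\<forall>\<B>. partition_on E \<B> \<and> (\<forall>g \<in> carrier G. \<forall>B \<in> \<B>. \<phi> g ` B \<in> \<B>)
          \<longrightarrow> \<B> = {E} \<or> \<B> = (\<lambda>x. {x}) ` E)"

text \<open>The action of a permutation of \<open>X\<close> on a set \<open>P\<close> of parts. A part is a set of edges, an edge
  is a set of vertices, and a vertex is a subset of \<open>X\<close>, whence the three nested images.
  The restriction to \<open>P\<close> is needed because elements of \<open>BijGroup P\<close> are extensional;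
  that \<open>P\<close> is preserved is part of \<open>group_action\<close>.\<close>

definition part_action ::
    "'a set set set set \<Rightarrow> ('a \<Rightarrow> 'a) \<Rightarrow> 'a set set set \<Rightarrow> 'a set set set" where
  "part_action P g = (\<lambda>D \<in> P. (`) ((`) ((`) g)) D)"

definition Sym_primitive_decomposition :: "'a set \<Rightarrow> nat \<Rightarrow> 'a set set set set \<Rightarrow> bool" where
  "Sym_primitive_decomposition X k P \<longleftrightarrow>
     decomposition (johnson_edges X k) P \<and> primitive_action (BijGroup X) P (part_action P)"

definition P_part :: "'a set \<Rightarrow> nat \<Rightarrow> 'a set \<Rightarrow> 'a set set set" where
  "P_part X k Y = nsets {A \<in> nsets X k. Y \<subseteq> A} 2"

definition P_cap :: "'a set \<Rightarrow> nat \<Rightarrow> 'a set set set set" where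
  "P_cap X k = {P_part X k Y | Y. Y \<in> nsets X (k - 1)}"

definition Q_part :: "nat \<Rightarrow> 'a set \<Rightarrow> 'a set set set" where
  "Q_part k W = nsets (nsets W k) 2"

definition P_cup :: "'a set \<Rightarrow> nat \<Rightarrow> 'a set set set set" where
  "P_cup X k = {Q_part k W | W. W \<in> nsets X (k + 1)}"

definition M_part :: "'a set \<Rightarrow> nat \<Rightarrow> 'a \<Rightarrow> 'a \<Rightarrow> 'a set set set" where
  "M_part X k a b = {{{a} \<union> Y, {b} \<union> Y} | Y. Y \<in> nsets (X - {a, b}) (k - 1)}"

definition P_ominus :: "'a set \<Rightarrow> nat \<Rightarrow> 'a set set set set" where
  "P_ominus X k = {M_part X k a b | a b. a \<in> X \<and> b \<in> X \<and> a \<noteq> b}"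

definition Q_pairs :: "'a set \<Rightarrow> nat \<Rightarrow> 'a set set set set" where
  "Q_pairs X k = {Q_part k W \<union> Q_part k (X - W) | W. W \<in> nsets X (k + 1)}"

definition pair_partitions :: "'a set \<Rightarrow> nat \<Rightarrow> 'a set set set" where
  "pair_partitions X m = {\<pi>. partition_on X \<pi> \<and> finite \<pi> \<and> card \<pi> = m \<and> (\<forall>p \<in> \<pi>. card p = 2)}"

definition four_cycles :: "'a set \<Rightarrow> 'a set set set set" where
  "four_cycles X = {{e \<in> johnson_edges X 2. e \<subseteq> nsets X 2 - \<pi>} | \<pi>. \<pi> \<in> pair_partitions X 2}"

definition pi_part :: "'a set \<Rightarrow> 'a set set \<Rightarrow> 'a set set set" where
  "pi_part X \<pi> = {{A, B} | A B. {A, B} \<in> johnson_edges X 3 \<and> sym_diff A B \<in> \<pi> \<and> A \<inter> B \<in> \<pi>}"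

definition pi_parts :: "'a set \<Rightarrow> 'a set set set set" where
  "pi_parts X = {pi_part X \<pi> | \<pi>. \<pi> \<in> pair_partitions X 3}"

text \<open>A divisor is regarded as a graph whose vertices are the ends of its edges. So graph
  isomorphism is stated for edge sets \<open>E\<close> with vertex set \<open>\<Union>E\<close>.\<close>

definition graph_iso :: "'v set set \<Rightarrow> 'w set set \<Rightarrow> bool" where
  "graph_iso E F \<longleftrightarrow> (\<exists>f. bij_betw f (\<Union>E) (\<Union>F) \<and> (`) f ` E = F)"

text \<open>\<open>r\<close> disjoint copies of the complete graph on \<open>m\<close> vertices (for \<open>m \<ge> 2\<close>), and
  the cycle of length \<open>m\<close> (for \<open>m \<ge> 3\<close>)\<close>

definition copies_complete :: "nat \<Rightarrow> nat \<Rightarrow> (nat \<times> nat) set set" where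
  "copies_complete r m = {{(i, u), (i, v)} | i u v. i < r \<and> u < m \<and> v < m \<and> u \<noteq> v}"

definition cycle_edges :: "nat \<Rightarrow> nat set set" where
  "cycle_edges m = {{i, (i + 1) mod m} | i. i < m}"

end

theory Submission
  imports Defs "HOL-Combinatorics.Permutations"
begin

text \<open>The transpositions that fix a part \<open>D\<close> define an equivalence relation on \<open>X\<close>.
  For an edge \<open>e\<close> of \<open>D\<close> each of the three cells \<open>\<Inter> e\<close>, \<open>\<Union> e - \<Inter> e\<close> and \<open>X - \<Union> e\<close> lies in one
  equivalence class. The classes cannot merge into a single one, because then all of
  \<open>Sym(X)\<close> would fix \<open>D\<close>. So the classes are either the three cells or a cell and
  its complement, and edge transitivity makes the type of merging the same for all edges.
  Hence the set of classes is a function \<open>F\<close> of the edge that is constant on parts,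
  equivariant and not constant. Primitivity forces the parts to be exactly the fibres of \<open>F\<close>.
  If the classes are the three cells, then one of the cells, being the only one of its size, is
  itself constant on parts and gives one of the other types, unless \<open>n = 6\<close> and \<open>k = 3\<close>.\<close>

section \<open>Edges of Johnson graphs\<close>

text \<open>Primitivity speaks about blocks of parts and gives no description of a single part; swap
  classes turn a part into a configuration of points of \<open>X\<close>, where counting is
  possible. They are accessible because parts are disjoint and permuted: a permutation sending one
  edge of a part into that part fixes the whole part, so every transposition that fixes an edge
  fixes its part. The blocks fed to primitivity consist of the parts with a common value of
  \<open>F\<close>. One single block would make \<open>F\<close> constant on all edges, which a well
  chosen transposition refutes; so each block is one part. The exceptional parameters are
  coincidences of sizes. With n = |X|, a pair {C, X - C} determines C by its size unless |C| = n/2.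
  For the common points k - 1 < n/2 always; for the union of an edge k + 1 = n/2 means n = 2k + 2;
  for the two ends 2 = n/2 means n = 4. The three cells have sizes k - 1, 2 and n - k - 1. These all
  agree only for k = 3 and n = 6, and among three sizes that do not all agree one occurs exactly
  once.\<close>

definition act :: "('a \<Rightarrow> 'a) \<Rightarrow> 'a set set \<Rightarrow> 'a set set" where
  "act g = (`) ((`) g)"

lemma act_id [simp]: "act id e = e" "act id ` D = D" "act (\<lambda>x. x) ` D = D"
  by (auto simp: act_def)

lemma act_comp: "act (f \<circ> g) e = act f (act g e)"
  by (auto simp: act_def image_comp)

lemma act_comp_image: "act (f \<circ> g) ` D = act f ` act g ` D"
  by (simp add: image_image act_comp)

lemma act_pair [simp]: "act g {A, B} = {g ` A, g ` B}"
  by (simp add: act_def)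

lemma Inter_act: "bij g \<Longrightarrow> \<Inter> (act g e) = g ` \<Inter> e"
  using bij_image_INT[of g "\<lambda>x. x" e] by (simp add: act_def)

lemma Union_act: "\<Union> (act g e) = g ` \<Union> e"
  by (auto simp: act_def)

text \<open>An edge \<open>e = {Y \<union> {a}, Y \<union> {b}}\<close> is handled through \<open>Y = \<Inter> e\<close> and
  \<open>{a, b} = \<Union> e - \<Inter> e\<close>, which avoids choosing representatives.\<close>

lemma johnson_edgeI:
  assumes "Y \<in> nsets X (k - 1)" "a \<in> X - Y" "b \<in> X - Y" "a \<noteq> b" "1 \<le> k"
  shows "{insert a Y, insert b Y} \<in> johnson_edges X k"
proof -
  have "insert a Y \<noteq> insert b Y" "insert a Y \<inter> insert b Y = Y"
    using assms by auto
  moreover have "insert a Y \<in> nsets X k" "insert b Y \<in> nsets X k" "card Y = k - 1"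
    using assms by (auto simp: nsets_def)
  ultimately show ?thesis
    unfolding johnson_edges_def by (intro CollectI exI[of _ "insert a Y"] exI[of _ "insert b Y"]) simp
qed

lemma johnson_edgeE:
  assumes "e \<in> johnson_edges X k" "1 \<le> k"
  obtains Y a b where "Y \<in> nsets X (k - 1)" "a \<in> X - Y" "b \<in> X - Y" "a \<noteq> b"
    "e = {insert a Y, insert b Y}" "\<Inter> e = Y" "\<Union> e - \<Inter> e = {a, b}"
    "\<Union> e = insert a (insert b Y)"
proof -
  obtain A B where AB: "e = {A, B}" "A \<in> nsets X k" "B \<in> nsets X k" "card (A \<inter> B) = k - 1"
    using assms by (auto simp: johnson_edges_def)
  have fin: "finite A" "finite B" and card: "card A = k" "card B = k"
    using AB by (auto simp: nsets_def)
  \<comment> \<open>Here \<open>1 \<le> k\<close> makes the truncated difference k - (k - 1) equal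
    to 1.\<close>
  have "card (A - B) = 1" "card (B - A) = 1"
    using card_Diff_subset_Int[of A B] card_Diff_subset_Int[of B A] fin card AB(4) assms(2)
    by (auto simp: Int_commute)
  then obtain a b where ab: "A - B = {a}" "B - A = {b}"
    by (metis card_1_singletonE)
  let ?Y = "A \<inter> B"
  have "A = insert a ?Y" "B = insert b ?Y"
    using ab by auto
  then have 1: "e = {insert a ?Y, insert b ?Y}"
    using AB by simp
  have 2: "?Y \<in> nsets X (k - 1)" "a \<in> X - ?Y" "b \<in> X - ?Y" "a \<noteq> b"
    using AB ab fin by (auto simp: nsets_def)
  show thesis
    by (rule that[OF 2 1]) (use 1 2 in auto)
qed

lemma johnson_edge_cards:
  assumes "e \<in> johnson_edges X k" "1 \<le> k" "finite X"
  shows "\<Inter> e \<subseteq> \<Union> e" "\<Union> e \<subseteq> X" "card (\<Inter> e) = k - 1" "card (\<Union> e) = k + 1"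
    "card (\<Union> e - \<Inter> e) = 2" "card (X - \<Union> e) = card X - (k + 1)"
    "card (X - \<Inter> e) = card X - (k - 1)" "card (X - (\<Union> e - \<Inter> e)) = card X - 2"
    "k + 1 \<le> card X"
proof -
  from assms obtain Y a b where *: "Y \<in> nsets X (k - 1)" "a \<in> X - Y" "b \<in> X - Y" "a \<noteq> b"
    "\<Inter> e = Y" "\<Union> e - \<Inter> e = {a, b}" "\<Union> e = insert a (insert b Y)"
    by (elim johnson_edgeE) auto
  have Y: "Y \<subseteq> X" "finite Y" "card Y = k - 1"
    using * by (auto simp: nsets_def)
  show "\<Inter> e \<subseteq> \<Union> e" and sub: "\<Union> e \<subseteq> X" and "card (\<Inter> e) = k - 1"
    and c: "card (\<Union> e) = k + 1"  and "card (\<Union> e - \<Inter> e) = 2"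
    using * Y assms by auto
  show "card (X - \<Union> e) = card X - (k + 1)"
    by (metis c sub assms(3) card_Diff_subset finite_subset)
  show "k + 1 \<le> card X"
    by (metis c sub assms(3) card_mono)
  show "card (X - \<Inter> e) = card X - (k - 1)"
    using * Y by (simp add: card_Diff_subset)
  show "card (X - (\<Union> e - \<Inter> e)) = card X - 2"
    using * by (subst card_Diff_subset) auto
qed

lemma act_johnson_edge:
  assumes "g permutes X" "e \<in> johnson_edges X k" "1 \<le> k"
  shows "act g e \<in> johnson_edges X k"
proof -
  from assms obtain Y a b where *: "Y \<in> nsets X (k - 1)" "a \<in> X - Y" "b \<in> X - Y" "a \<noteq> b"
    "e = {insert a Y, insert b Y}"
    by (elim johnson_edgeE) auto
  have inj: "inj g"
    using assms(1) by (rule permutes_inj)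
  have "g ` Y \<in> nsets X (k - 1)"
    using * assms(1) permutes_in_image[OF assms(1)]
    by (auto simp: nsets_def card_image inj_on_subset[OF inj])
  moreover have "g a \<in> X - g ` Y" "g b \<in> X - g ` Y" "g a \<noteq> g b"
    using * inj permutes_in_image[OF assms(1)] by (auto simp: inj_image_mem_iff inj_eq)
  ultimately show ?thesis
    using * assms(3) johnson_edgeI[of "g ` Y" X k "g a" "g b"] by simp
qed

lemma permutes_extend_bij_betw:
  assumes "finite X" "A \<subseteq> X" "B \<subseteq> X" "bij_betw f A B"
  obtains g where "g permutes X" "\<And>x. x \<in> A \<Longrightarrow> g x = f x"
proof -
  have "card (X - A) = card (X - B)"
    using assms by (metis bij_betw_same_card card_Diff_subset finite_subset)
  then obtain h where h: "bij_betw h (X - A) (X - B)"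
    using assms finite_same_card_bij by blast
  have "bij_betw (\<lambda>x. if x \<in> A then f x else h x) (A \<union> (X - A)) (B \<union> (X - B))"
    using assms h by (intro bij_betw_disjoint_Un) auto
  moreover have "A \<union> (X - A) = X" "B \<union> (X - B) = X"
    using assms by auto
  ultimately have "bij_betw (\<lambda>x. if x \<in> A then f x else h x) X X"
    by simp
  \<comment> \<open>The outer conditional makes the map the identity off \<open>X\<close>, as
    \<open>permutes\<close> demands.\<close>
  then have "bij_betw (\<lambda>x. if x \<in> X then if x \<in> A then f x else h x else x) X X"
    by (rule bij_betw_cong[THEN iffD1, rotated]) simp
  then have "(\<lambda>x. if x \<in> X then if x \<in> A then f x else h x else x) permutes X"
    by (rule bij_imp_permutes) simp
  then show thesis
    by (rule that) (use assms(2) in auto)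
qed

text \<open>An edge amounts to k - 1 common points and two further points. Matching these data for
  two edges is a bijection between (k + 1)-subsets, and it extends to all of \<open>X\<close>
  because the complements have equal size.\<close>

lemma johnson_edges_transitive:
  assumes "finite X" "1 \<le> k" "e \<in> johnson_edges X k" "e' \<in> johnson_edges X k"
  obtains g where "g permutes X" "act g e = e'"
proof -
  from assms obtain Y a b where *: "Y \<in> nsets X (k - 1)" "a \<in> X - Y" "b \<in> X - Y" "a \<noteq> b"
    "e = {insert a Y, insert b Y}"
    by (elim johnson_edgeE) auto
  from assms obtain Y' a' b' where **: "Y' \<in> nsets X (k - 1)" "a' \<in> X - Y'" "b' \<in> X - Y'"
    "a' \<noteq> b'" "e' = {insert a' Y', insert b' Y'}"
    by (elim johnson_edgeE) auto
  obtain h where h: "bij_betw h Y Y'"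
    using * ** finite_same_card_bij[of Y Y'] by (auto simp: nsets_def)
  let ?f = "\<lambda>x. if x \<in> Y then h x else if x = a then a' else b'"
  have "bij_betw ?f (Y \<union> {a, b}) (Y' \<union> {a', b'})"
    using * ** h by (intro bij_betw_disjoint_Un) (auto simp: bij_betw_def)
  then obtain g where g: "g permutes X" "\<And>x. x \<in> Y \<union> {a, b} \<Longrightarrow> g x = ?f x"
    using permutes_extend_bij_betw[of X "Y \<union> {a, b}" "Y' \<union> {a', b'}" ?f] assms(1) * **
    by (auto simp: nsets_def)
  have "g ` Y = h ` Y"
    using g(2) by (intro image_cong) auto
  then have "g ` Y = Y'"
    using h by (simp add: bij_betw_def)
  moreover have "g a = a'" "g b = b'"
    using g(2)[of a] g(2)[of b] * by auto
  ultimately show thesis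
    using * ** g by (intro that[of g]) auto
qed

text \<open>A transposition of two common or two outside points fixes both vertices of the edge;
  that of the two ends exchanges the vertices.\<close>

lemma act_transpose_eq:
  assumes "e \<in> johnson_edges X k" "1 \<le> k"
    "x \<in> \<Inter> e \<and> y \<in> \<Inter> e \<or> x \<in> \<Union> e - \<Inter> e \<and> y \<in> \<Union> e - \<Inter> e \<or> x \<notin> \<Union> e \<and> y \<notin> \<Union> e"
  shows "act (Transposition.transpose x y) e = e"
proof -
  from assms obtain Y a b where *: "Y \<in> nsets X (k - 1)" "a \<in> X - Y" "b \<in> X - Y" "a \<noteq> b"
    "e = {insert a Y, insert b Y}" "\<Inter> e = Y" "\<Union> e - \<Inter> e = {a, b}"
    "\<Union> e = insert a (insert b Y)"
    by (elim johnson_edgeE) auto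
  consider "x \<in> Y" "y \<in> Y" | "x = a" "y = b" | "x = b" "y = a" | "x = y"
    | "x \<notin> insert a (insert b Y)" "y \<notin> insert a (insert b Y)"
    using assms(3) unfolding *(7) unfolding *(6,8) by auto
  then show ?thesis
  proof cases
    case 1
    then have "Transposition.transpose x y a = a" "Transposition.transpose x y b = b"
      using * by (auto intro!: transpose_apply_other)
    with 1 show ?thesis
      using * by simp
  next
    case 5
    then have "Transposition.transpose x y a = a" "Transposition.transpose x y b = b"
      by (auto intro!: transpose_apply_other)
    with 5 show ?thesis
      using *(5) by simp
  qed (use *(2-5) in \<open>auto simp: insert_commute\<close>)
qed

section \<open>Transpositions fixing a part\<close>

text \<open>Names for the cells, so that the merging of cells can be stated without reference to a
  particular edge.\<close>

datatype cell_name = Common | Ends | Outside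

text \<open>The hypotheses rephrased for \<open>permutes\<close>, which supplies composition,
  inverses and induction over transpositions. The map \<open>act g\<close> moves edges, its image
  moves parts, and the image of that moves blocks of parts.\<close>

locale johnson_decomposition =
  fixes X :: "'a set" and k :: nat and P :: "'a set set set set"
  assumes finite_X: "finite X"
    and k_ge: "2 \<le> k"
    and card_X: "2 * k \<le> card X"
    and P_partition: "partition_on (johnson_edges X k) P"
    and card_P: "2 \<le> card P"
    and act_P: "\<And>g D. g permutes X \<Longrightarrow> D \<in> P \<Longrightarrow> act g ` D \<in> P"
    and primitive: "\<And>\<B>. partition_on P \<B> \<Longrightarrow>
      (\<And>g B. g permutes X \<Longrightarrow> B \<in> \<B> \<Longrightarrow> (`) (act g) ` B \<in> \<B>) \<Longrightarrow>
      \<B> = {P} \<or> \<B> = (\<lambda>D. {D}) ` P"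
begin

lemma k_ge_1: "1 \<le> k"
  using k_ge by simp

lemma edge_if_in_part: "D \<in> P \<Longrightarrow> e \<in> D \<Longrightarrow> e \<in> johnson_edges X k"
  using P_partition by (auto simp: partition_on_def)

lemma part_unique: "D \<in> P \<Longrightarrow> D' \<in> P \<Longrightarrow> e \<in> D \<Longrightarrow> e \<in> D' \<Longrightarrow> D = D'"
  using P_partition by (auto simp: partition_on_def disjoint_def)

lemma part_nonempty: "D \<in> P \<Longrightarrow> \<exists>e. e \<in> D"
  using P_partition by (metis partition_on_def ex_in_conv)

lemma part_exists: "e \<in> johnson_edges X k \<Longrightarrow> \<exists>D\<in>P. e \<in> D"
  using P_partition by (auto simp: partition_on_def)

text \<open>The image of \<open>D\<close> is again a part, and parts sharing an edge coincide; hence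
  one edge decides where the whole part goes.\<close>

lemma act_part_eqI:
  "g permutes X \<Longrightarrow> D \<in> P \<Longrightarrow> D' \<in> P \<Longrightarrow> e \<in> D \<Longrightarrow> act g e \<in> D' \<Longrightarrow> act g ` D = D'"
  using act_P part_unique by blast

definition swappable :: "'a set set set \<Rightarrow> 'a \<Rightarrow> 'a \<Rightarrow> bool" where
  "swappable D x y \<longleftrightarrow> act (Transposition.transpose x y) ` D = D"

lemma swappable_refl: "swappable D x x"
  by (simp add: swappable_def)

lemma swappable_sym: "swappable D x y \<Longrightarrow> swappable D y x"
  by (simp add: swappable_def transpose_commute)

lemma swappable_trans:
  assumes "swappable D x y" "swappable D y z"
  shows "swappable D x z"
proof (cases "x = z \<or> y = z")
  case True
  then show ?thesis
    using assms swappable_refl by auto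
next
  case False
  \<comment> \<open>Conjugating (y z) by (x y) gives (x z). The identity requires \<open>z\<close>
    to differ from \<open>x\<close> and \<open>y\<close>, hence the case distinction.\<close>
  then have "act (Transposition.transpose x z) ` D
      = act (Transposition.transpose x y \<circ> Transposition.transpose y z \<circ> Transposition.transpose x y) ` D"
    by (subst transpose_comp_triple) auto
  then show ?thesis
    using assms by (simp add: swappable_def act_comp_image)
qed

text \<open>Conjugating the transposition (x y) by \<open>g\<close> gives the transposition (g x, g
  y).\<close>

lemma swappable_act:
  assumes "bij g" "swappable D x y"
  shows "swappable (act g ` D) (g x) (g y)"
proof -
  have "Transposition.transpose (g x) (g y) \<circ> g = g \<circ> Transposition.transpose x y"
    using assms(1) by (simp add: transpose_comp_eq bij_is_inj)
  then show ?thesis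
    using assms(2) unfolding swappable_def act_comp_image[symmetric]
    by (simp add: act_comp_image)
qed

text \<open>The transposition fixes the edge \<open>e\<close> itself and therefore the part that
  contains it.\<close>

lemma swappable_if_same_cell:
  assumes "D \<in> P" "e \<in> D" "x \<in> X" "y \<in> X"
    "x \<in> \<Inter> e \<and> y \<in> \<Inter> e \<or> x \<in> \<Union> e - \<Inter> e \<and> y \<in> \<Union> e - \<Inter> e \<or> x \<notin> \<Union> e \<and> y \<notin> \<Union> e"
  shows "swappable D x y"
proof -
  have "act (Transposition.transpose x y) e = e"
    using act_transpose_eq[OF edge_if_in_part[OF assms(1,2)] k_ge_1 assms(5)] .
  then show ?thesis
    unfolding swappable_def using assms permutes_swap_id
    by (intro act_part_eqI[of _ D D e]) auto
qed

text \<open>Transpositions generate the symmetric group, which is transitive on edges. A part fixed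
  by all of them would contain every edge, although there are at least two parts.\<close>

lemma not_swappable_all:
  assumes "D \<in> P"
  shows "\<exists>x\<in>X. \<exists>y\<in>X. \<not> swappable D x y"
proof (rule ccontr)
  assume "\<not> ?thesis"
  then have all: "\<And>x y. x \<in> X \<Longrightarrow> y \<in> X \<Longrightarrow> swappable D x y"
    by auto
  have fix_D: "act g ` D = D" if "g permutes X" for g
    using that finite_X
  proof (induction rule: permutes_induct)
    case (swap a b p)
    then show ?case
      using all[of a b] by (simp add: swappable_def act_comp_image del: comp_apply)
  qed simp
  obtain e where e: "e \<in> D"
    using assms part_nonempty by blast
  have "D' = D" if D': "D' \<in> P" for D'
  proof -
    obtain e' where e': "e' \<in> D'"
      using D' part_nonempty by blast
    obtain g where "g permutes X" "act g e = e'"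
      using johnson_edges_transitive[OF finite_X k_ge_1 edge_if_in_part[OF assms e]
          edge_if_in_part[OF D' e']] by blast
    then show ?thesis
      using act_part_eqI[of g D D' e] fix_D e e' assms D' by auto
  qed
  then have "P \<subseteq> {D}"
    by auto
  then show False
    using card_P card_mono[of "{D}" P] by simp
qed

section \<open>The three cells of an edge and the ways in which swap classes merge them\<close>

fun cell :: "cell_name \<Rightarrow> 'a set set \<Rightarrow> 'a set" where
  "cell Common e = \<Inter> e"
| "cell Ends e = \<Union> e - \<Inter> e"
| "cell Outside e = X - \<Union> e"

lemma cell_act:
  assumes "g permutes X"
  shows "cell i (act g e) = g ` cell i e"
proof -
  have "bij g" "inj g" "g ` X = X"
    using assms by (simp_all add: permutes_bij permutes_inj permutes_image)
  then show ?thesis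
    by (cases i) (simp_all add: Inter_act Union_act image_set_diff)
qed

text \<open>The sizes k - 1, 2 and n - k - 1 (n = |X|) are positive by \<open>k_ge\<close> and
  \<open>card_X\<close>. Thus every cell name has a point that represents it, which the transitivity
  of \<open>linked\<close> and the description of the classes rely on.\<close>

lemma cell_nonempty:
  assumes "D \<in> P" "e \<in> D"
  shows "cell i e \<noteq> {}"
proof -
  note c = johnson_edge_cards[OF edge_if_in_part[OF assms] k_ge_1 finite_X]
  have "card (cell i e) \<noteq> 0"
    using c(3,5,6) k_ge card_X by (cases i) (simp_all del: card_0_eq)
  then show ?thesis
    by fastforce
qed

lemma cell_subset:
  assumes "D \<in> P" "e \<in> D"
  shows "cell i e \<subseteq> X"
  using johnson_edge_cards(1,2)[OF edge_if_in_part[OF assms] k_ge_1 finite_X]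
  by (cases i) auto

lemma cell_exists: "x \<in> X \<Longrightarrow> \<exists>i. x \<in> cell i e"
  using cell.simps by (metis Diff_iff)

lemma swappable_cell:
  assumes "D \<in> P" "e \<in> D" "x \<in> cell i e" "y \<in> cell i e"
  shows "swappable D x y"
  using swappable_if_same_cell[OF assms(1,2), of x y] cell_subset[OF assms(1,2), of i] assms(3,4)
  by (cases i) auto

text \<open>Existential in part, edge and points, which makes it a relation on names alone;
  \<open>swappable_iff_linked\<close> shows that the choices do not matter.\<close>

definition linked :: "cell_name \<Rightarrow> cell_name \<Rightarrow> bool" where
  "linked i j \<longleftrightarrow> (\<exists>D\<in>P. \<exists>e\<in>D. \<exists>x\<in>cell i e. \<exists>y\<in>cell j e. swappable D x y)"

text \<open>By edge transitivity, which cells of an edge are related does not depend on the edge.\<close>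

lemma swappable_iff_linked:
  assumes "D \<in> P" "e \<in> D" "x \<in> cell i e" "y \<in> cell j e"
  shows "swappable D x y \<longleftrightarrow> linked i j"
proof
  assume "linked i j"
  then obtain D' e' x' y' where *: "D' \<in> P" "e' \<in> D'" "x' \<in> cell i e'" "y' \<in> cell j e'" "swappable D' x' y'"
    by (auto simp: linked_def)
  obtain g where g: "g permutes X" "act g e' = e"
    using johnson_edges_transitive[OF finite_X k_ge_1 edge_if_in_part[OF *(1,2)]
        edge_if_in_part[OF assms(1,2)]] by blast
  then have "act g ` D' = D"
    using act_part_eqI[of g D' D e'] assms * by auto
  then have "swappable D (g x') (g y')"
    using swappable_act[OF permutes_bij[OF g(1)] *(5)] by simp
  \<comment> \<open>The permutation \<open>g\<close> need not send \<open>x'\<close> to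
    \<open>x\<close> or \<open>y'\<close> to \<open>y\<close>; it sends them into the right cells of
    \<open>e\<close>, and points of one cell are swappable.\<close>
  moreover have "swappable D x (g x')" "swappable D (g y') y"
    using swappable_cell[OF assms(1,2)] assms * g cell_act by blast+
  ultimately show "swappable D x y"
    using swappable_trans by blast
next
  assume "swappable D x y"
  then show "linked i j"
    unfolding linked_def using assms by blast
qed

lemma linked_refl: "linked i i"
proof -
  obtain D where "D \<in> P"
    using card_P by (cases "P = {}") auto
  then obtain e x where "e \<in> D" "x \<in> cell i e"
    using part_nonempty cell_nonempty by blast
  then show ?thesis
    using \<open>D \<in> P\<close> swappable_refl linked_def by blast
qed

lemma linked_sym: "linked i j \<Longrightarrow> linked j i"
  unfolding linked_def using swappable_sym by blast

lemma linked_trans: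
  assumes "linked i j" "linked j l"
  shows "linked i l"
proof -
  obtain D e x y where *: "D \<in> P" "e \<in> D" "x \<in> cell i e" "y \<in> cell j e" "swappable D x y"
    using assms(1) by (auto simp: linked_def)
  obtain z where z: "z \<in> cell l e"
    using cell_nonempty * by blast
  then have "swappable D y z"
    using swappable_iff_linked * assms(2) by blast
  then show ?thesis
    using swappable_trans * z unfolding linked_def by blast
qed

lemma not_linked_all: "\<exists>i j. \<not> linked i j"
proof -
  obtain D where D: "D \<in> P"
    using card_P by (cases "P = {}") auto
  then obtain e where e: "e \<in> D"
    using part_nonempty by blast
  obtain x y where xy: "x \<in> X" "y \<in> X" "\<not> swappable D x y"
    using not_swappable_all D by blast
  obtain i j where "x \<in> cell i e" "y \<in> cell j e"
    using cell_exists xy by blast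
  then show ?thesis
    using swappable_iff_linked D e xy by blast
qed

definition swap_classes :: "'a set set set \<Rightarrow> 'a set set" where
  "swap_classes D = (\<lambda>x. {y \<in> X. swappable D x y}) ` X"

text \<open>Swappability depends only on the cells of the two points, so the class of a point of
  cell \<open>i\<close> is the union of the cells linked to \<open>i\<close>. Each \<open>i\<close>
  does occur, since no cell is empty.\<close>

lemma swap_classes_linked:
  assumes "D \<in> P" "e \<in> D"
  shows "swap_classes D = range (\<lambda>i. \<Union>j\<in>{j. linked i j}. cell j e)"
proof -
  have cl: "{y \<in> X. swappable D x y} = (\<Union>j\<in>{j. linked i j}. cell j e)" if "x \<in> cell i e" for x i
  proof (intro Set.set_eqI iffI)
    fix y assume y: "y \<in> {y \<in> X. swappable D x y}"
    then obtain j where "y \<in> cell j e"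
      using cell_exists[of y e] by blast
    then show "y \<in> (\<Union>j\<in>{j. linked i j}. cell j e)"
      using swappable_iff_linked[OF assms that, of y j] y by blast
  next
    fix y assume "y \<in> (\<Union>j\<in>{j. linked i j}. cell j e)"
    then show "y \<in> {y \<in> X. swappable D x y}"
      using swappable_iff_linked[OF assms that] cell_subset[OF assms] by blast
  qed
  show ?thesis
    unfolding swap_classes_def
  proof (intro equalityI subsetI)
    fix C assume "C \<in> (\<lambda>x. {y \<in> X. swappable D x y}) ` X"
    then obtain x where x: "x \<in> X" "C = {y \<in> X. swappable D x y}"
      by blast
    then obtain i where "x \<in> cell i e"
      using cell_exists[of x e] by blast
    then show "C \<in> range (\<lambda>i. \<Union>j\<in>{j. linked i j}. cell j e)"
      using cl[of x i] x by simp
  next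
    fix C assume "C \<in> range (\<lambda>i. \<Union>j\<in>{j. linked i j}. cell j e)"
    then obtain i where i: "C = (\<Union>j\<in>{j. linked i j}. cell j e)"
      by blast
    obtain x where "x \<in> cell i e"
      using cell_nonempty[OF assms] by blast
    then show "C \<in> (\<lambda>x. {y \<in> X. swappable D x y}) ` X"
      using cl[of x i] i cell_subset[OF assms, of i] by blast
  qed
qed

text \<open>A three-element set carries five equivalence relations. As \<open>linked\<close> is not
  the total one, four remain: one merged pair of names in three ways, or none. The same case holds
  for all parts and edges at once because \<open>linked\<close> mentions none.\<close>

lemma swap_classes_cases:
  obtains
    (Common) "\<And>D e. D \<in> P \<Longrightarrow> e \<in> D \<Longrightarrow> swap_classes D = {\<Inter> e, X - \<Inter> e}"
  | (Span) "\<And>D e. D \<in> P \<Longrightarrow> e \<in> D \<Longrightarrow> swap_classes D = {\<Union> e, X - \<Union> e}"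
  | (Ends) "\<And>D e. D \<in> P \<Longrightarrow> e \<in> D \<Longrightarrow> swap_classes D = {\<Union> e - \<Inter> e, X - (\<Union> e - \<Inter> e)}"
  | (Cells) "\<And>D e. D \<in> P \<Longrightarrow> e \<in> D \<Longrightarrow> swap_classes D = {\<Inter> e, \<Union> e - \<Inter> e, X - \<Union> e}"
proof -
  have names: "UNIV = {Common, Ends, Outside}"
    using cell_name.exhaust by auto
  have rng: "range f = {f Common, f Ends, f Outside}" for f :: "cell_name \<Rightarrow> 'a set"
    by (simp add: names)
  have un: "(\<Union>j\<in>{j. linked i j}. cell j e) = (if linked i Common then cell Common e else {})
      \<union> (if linked i Ends then cell Ends e else {}) \<union> (if linked i Outside then cell Outside e else {})"
    for i e
  proof -
    have "{j. linked i j} = {j \<in> {Common, Ends, Outside}. linked i j}"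
      using names by auto
    then show ?thesis
      by (auto simp del: cell.simps)
  qed
  have sym: "linked Ends Common = linked Common Ends" "linked Outside Common = linked Common Outside"
    "linked Outside Ends = linked Ends Outside"
    using linked_sym by blast+
  have sub: "\<Inter> e \<subseteq> \<Union> e" "\<Union> e \<subseteq> X" if "D \<in> P" "e \<in> D" for D e
    using johnson_edge_cards(1,2)[OF edge_if_in_part[OF that] k_ge_1 finite_X] .
  note eq = swap_classes_linked[unfolded rng un sym, simplified linked_refl if_True]
  have not_all: "\<not> (linked Common Ends \<and> linked Ends Outside \<and> linked Common Outside)"
    using not_linked_all linked_refl sym by (metis cell_name.exhaust)
  have tr: "linked Common Ends \<Longrightarrow> linked Ends Outside \<Longrightarrow> linked Common Outside"
    "linked Common Ends \<Longrightarrow> linked Common Outside \<Longrightarrow> linked Ends Outside"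
    "linked Common Outside \<Longrightarrow> linked Ends Outside \<Longrightarrow> linked Common Ends"
    using linked_trans linked_sym by blast+
  consider "linked Common Ends" "\<not> linked Ends Outside" "\<not> linked Common Outside"
    | "\<not> linked Common Ends" "linked Ends Outside" "\<not> linked Common Outside"
    | "\<not> linked Common Ends" "\<not> linked Ends Outside" "linked Common Outside"
    | "\<not> linked Common Ends" "\<not> linked Ends Outside" "\<not> linked Common Outside"
    using not_all tr by blast
  then show thesis
  proof cases
    case 1
    show thesis
    proof (rule Span)
      fix D e assume De: "D \<in> P" "e \<in> D"
      have "\<Inter> e \<union> (\<Union> e - \<Inter> e) = \<Union> e"
        using sub[OF De] by blast
      then show "swap_classes D = {\<Union> e, X - \<Union> e}"
        unfolding eq[OF De] using 1 by simp
    qed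
  next
    case 2
    show thesis
    proof (rule Common)
      fix D e assume De: "D \<in> P" "e \<in> D"
      have "(\<Union> e - \<Inter> e) \<union> (X - \<Union> e) = X - \<Inter> e"
        using sub[OF De] by blast
      then show "swap_classes D = {\<Inter> e, X - \<Inter> e}"
        unfolding eq[OF De] using 2 by simp
    qed
  next
    case 3
    show thesis
    proof (rule Ends)
      fix D e assume De: "D \<in> P" "e \<in> D"
      have "\<Inter> e \<union> (X - \<Union> e) = X - (\<Union> e - \<Inter> e)"
        using sub[OF De] by blast
      then show "swap_classes D = {\<Union> e - \<Inter> e, X - (\<Union> e - \<Inter> e)}"
        unfolding eq[OF De] using 3 by auto
    qed
  next
    case 4
    show thesis
      by (rule Cells) (use eq 4 in auto)
  qed
qed

end

section \<open>Parts are fibres\<close>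

context johnson_decomposition
begin

text \<open>The parts on which \<open>F\<close> takes a given value form a block:
  \<open>const\<close> makes the blocks disjoint and \<open>F_act\<close> makes them invariant.
  Primitivity leaves a single block or singletons. The assumptions \<open>disj\<close> and
  \<open>big\<close> serve to exclude the single block, and singleton blocks say that distinct parts
  have distinct values of \<open>F\<close>.\<close>

lemma parts_eq_fibres:
  fixes F :: "'a set set \<Rightarrow> 'a set set"
  assumes F_act: "\<And>g e. g permutes X \<Longrightarrow> F (act g e) = (`) g ` F e"
    and const: "\<And>D e f. D \<in> P \<Longrightarrow> e \<in> D \<Longrightarrow> f \<in> D \<Longrightarrow> F e = F f"
    and disj: "\<And>e. e \<in> johnson_edges X k \<Longrightarrow> disjoint (F e)"
    and big: "\<And>e. e \<in> johnson_edges X k \<Longrightarrow> \<exists>C\<in>F e. \<Union> e - \<Inter> e \<subseteq> C \<and> C \<subset> X"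
  shows "P = (\<lambda>e. {f \<in> johnson_edges X k. F f = F e}) ` johnson_edges X k"
proof -
  define \<B> where "\<B> = (\<lambda>e. {D \<in> P. \<exists>f\<in>D. F f = F e}) ` johnson_edges X k"
  have "partition_on P \<B>"
  proof (rule partition_onI)
    show "\<Union> \<B> = P"
    proof (intro equalityI subsetI)
      fix D assume "D \<in> P"
      moreover obtain e where "e \<in> D"
        using part_nonempty calculation by blast
      ultimately show "D \<in> \<Union> \<B>"
        unfolding \<B>_def using edge_if_in_part by blast
    qed (auto simp: \<B>_def)
    show "disjnt p q" if p: "p \<in> \<B>" and q: "q \<in> \<B>" and pq: "p \<noteq> q" for p q
    proof -
      obtain e where e: "p = {D \<in> P. \<exists>f\<in>D. F f = F e}"
        using p by (auto simp: \<B>_def)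
      obtain e' where e': "q = {D \<in> P. \<exists>f\<in>D. F f = F e'}"
        using q by (auto simp: \<B>_def)
      have "F e \<noteq> F e'"
        using pq e e' by auto
      then show ?thesis
        using const unfolding disjnt_def e e' by blast
    qed
    show "{} \<notin> \<B>"
      using part_exists unfolding \<B>_def by blast
  qed
  moreover have "(`) (act g) ` B \<in> \<B>" if g: "g permutes X" and B: "B \<in> \<B>" for g B
  proof -
    obtain e where e: "e \<in> johnson_edges X k" "B = {D \<in> P. \<exists>f\<in>D. F f = F e}"
      using B by (auto simp: \<B>_def)
    have "(`) (act g) ` B = {D \<in> P. \<exists>f\<in>D. F f = F (act g e)}"
    proof (intro equalityI subsetI)
      fix D assume "D \<in> (`) (act g) ` B"
      then obtain D' f where D': "D' \<in> P" "D = act g ` D'" "f \<in> D'" "F f = F e"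
        using e by auto
      then have "F (act g f) = F (act g e)"
        using F_act g by simp
      then show "D \<in> {D \<in> P. \<exists>f\<in>D. F f = F (act g e)}"
        using D' act_P[OF g] by auto
    next
      fix D assume "D \<in> {D \<in> P. \<exists>f\<in>D. F f = F (act g e)}"
      then obtain f where f: "D \<in> P" "f \<in> D" "F f = F (act g e)"
        by blast
      \<comment> \<open>For the reverse inclusion \<open>D\<close> is pulled back by the inverse
        permutation into the block \<open>B\<close>.\<close>
      have inv: "inv_into UNIV g permutes X"
        using g by (rule permutes_inv)
      have "F (act (inv_into UNIV g) f) = F (act (inv_into UNIV g) (act g e))"
        using F_act[OF inv] f(3) by simp
      also have "act (inv_into UNIV g) (act g e) = e"
        using g by (simp add: act_comp[symmetric] permutes_inv_o)
      finally have "act (inv_into UNIV g) ` D \<in> B"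
        using e f act_P[OF inv] by auto
      moreover have "act g ` act (inv_into UNIV g) ` D = D"
        using g by (simp add: act_comp_image[symmetric] permutes_inv_o del: comp_apply)
      ultimately show "D \<in> (`) (act g) ` B"
        by (metis imageI)
    qed
    then show ?thesis
      unfolding \<B>_def using act_johnson_edge[OF g e(1) k_ge_1] by auto
  qed
  ultimately have "\<B> = {P} \<or> \<B> = (\<lambda>D. {D}) ` P"
    by (rule primitive)
  moreover have "\<B> \<noteq> {P}"
  proof
    assume eq: "\<B> = {P}"
    obtain D where "D \<in> P"
      using card_P by (cases "P = {}") auto
    then obtain e where e: "e \<in> johnson_edges X k"
      using part_nonempty edge_if_in_part by blast
    obtain a b where ab: "a \<in> X" "b \<in> X" "a \<noteq> b" "\<Union> e - \<Inter> e = {a, b}"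
      using e k_ge_1 by (elim johnson_edgeE) auto
    obtain C where C: "C \<in> F e" "\<Union> e - \<Inter> e \<subseteq> C" "C \<subset> X"
      using big e by blast
    then obtain y where y: "y \<in> X" "y \<notin> C"
      by blast
    \<comment> \<open>This exchanges the end \<open>a\<close> with a point outside \<open>C\<close>.
      If \<open>F\<close> were constant, the image of \<open>C\<close> would again be a member of
      \<open>F e\<close>; it has lost \<open>a\<close> but kept the other end \<open>b\<close>, so
      it differs from \<open>C\<close> and yet meets it, against \<open>disj\<close>. This is why
      \<open>big\<close> asks for a member containing both ends.\<close>
    let ?g = "Transposition.transpose a y"
    have g: "?g permutes X"
      using ab y by (intro permutes_swap_id)
    then have e': "act ?g e \<in> johnson_edges X k"
      using act_johnson_edge e k_ge_1 by blast
    obtain D' where D': "D' \<in> P" "act ?g e \<in> D'"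
      using part_exists[OF e'] by blast
    have "{D \<in> P. \<exists>f\<in>D. F f = F e} \<in> \<B>"
      unfolding \<B>_def using e by (rule imageI)
    then have "D' \<in> {D \<in> P. \<exists>f\<in>D. F f = F e}"
      using eq D'(1) by simp
    then have "F (act ?g e) = F e"
      using const[OF D'(1) D'(2)] by auto
    then have "?g ` C \<in> F e"
      using F_act[OF g] C(1) by blast
    moreover have "b \<in> ?g ` C"
    proof -
      have "?g b = b"
        using ab C y by (intro transpose_apply_other) auto
      then show ?thesis
        using ab C(2) by (metis insertI1 insert_commute image_eqI subsetD)
    qed
    moreover have "a \<notin> ?g ` C"
      using y by (simp add: in_transpose_image_iff)
    moreover have "a \<in> C" "b \<in> C"
      using C(2) ab(4) by auto
    ultimately show False
      using disjointD[OF disj[OF e] C(1), of "?g ` C"] by auto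
  qed
  ultimately have \<B>: "\<B> = (\<lambda>D. {D}) ` P"
    by blast
  \<comment> \<open>Since blocks are singletons, any part with an edge of value \<open>F e\<close>
    is \<open>D\<close>; conversely \<open>F\<close> is constant on \<open>D\<close>.\<close>
  have fibre: "{f \<in> johnson_edges X k. F f = F e} = D" if D: "D \<in> P" and e: "e \<in> D" for D e
  proof -
    have "{D \<in> P. \<exists>f\<in>D. F f = F e} \<in> \<B>"
      unfolding \<B>_def using edge_if_in_part[OF that] by (rule imageI)
    then obtain D' where "{D \<in> P. \<exists>f\<in>D. F f = F e} = {D'}"
      unfolding \<B> by blast
    moreover have "D \<in> {D \<in> P. \<exists>f\<in>D. F f = F e}"
      using D e by blast
    ultimately have "{D \<in> P. \<exists>f\<in>D. F f = F e} = {D}"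
      by simp
    then have uniq: "D'' = D" if "D'' \<in> P" "f \<in> D''" "F f = F e" for D'' f
      using that by blast
    show ?thesis
    proof (intro equalityI subsetI)
      fix f assume "f \<in> {f \<in> johnson_edges X k. F f = F e}"
      then show "f \<in> D"
        using part_exists[of f] uniq by blast
    next
      fix f assume "f \<in> D"
      then show "f \<in> {f \<in> johnson_edges X k. F f = F e}"
        using const[OF D _ e] edge_if_in_part[OF D] by blast
    qed
  qed
  show ?thesis
  proof (intro equalityI subsetI)
    fix D assume D: "D \<in> P"
    then obtain e where e: "e \<in> D"
      using part_nonempty by blast
    then show "D \<in> (\<lambda>e. {f \<in> johnson_edges X k. F f = F e}) ` johnson_edges X k"
      using fibre[OF D e] edge_if_in_part[OF D e] by blast
  next
    fix D assume "D \<in> (\<lambda>e. {f \<in> johnson_edges X k. F f = F e}) ` johnson_edges X k"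
    then obtain e where e: "e \<in> johnson_edges X k" "D = {f \<in> johnson_edges X k. F f = F e}"
      by blast
    obtain D' where D': "D' \<in> P" "e \<in> D'"
      using part_exists e by blast
    then show "D \<in> P"
      using fibre e by simp
  qed
qed

end

text \<open>Elements of \<open>BijGroup X\<close> are undefined off \<open>X\<close>, whereas
  \<open>permutes\<close> requires the identity there. Vertices are subsets of \<open>X\<close>, so
  two maps that agree on \<open>X\<close> act alike on edges and parts. Restriction translates in
  one direction, extension by the identity in the other.\<close>

lemma Sym_primitive_decomposition_imp:
  assumes "finite X" "2 \<le> k" "2 * k \<le> card X" "Sym_primitive_decomposition X k P"
  shows "johnson_decomposition X k P"
proof
  have P: "partition_on (johnson_edges X k) P" "2 \<le> card P"
    and prim: "primitive_action (BijGroup X) P (part_action P)"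
    using assms(4) by (auto simp: Sym_primitive_decomposition_def decomposition_def)
  have GA: "group_action (BijGroup X) P (part_action P)"
    using prim by (auto simp: primitive_action_def transitive_action_def)
  have edge_sub: "A \<subseteq> X" if "e \<in> johnson_edges X k" "A \<in> e" for e A
    using that by (auto simp: johnson_edges_def nsets_def)
  have act_cong: "act g e = act h e"
    if e: "e \<in> johnson_edges X k" and gh: "\<And>x. x \<in> X \<Longrightarrow> g x = h x" for g h e
    unfolding act_def using edge_sub[OF e] gh by (intro image_cong) auto
  have part_act: "part_action P g D = act h ` D"
    if D: "D \<in> P" and gh: "\<And>x. x \<in> X \<Longrightarrow> g x = h x" for g h D
  proof -
    have "act g ` D = act h ` D"
      using D P(1) gh by (intro image_cong act_cong) (auto simp: partition_on_def)
    then show ?thesis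
      using D by (simp add: part_action_def act_def)
  qed
  show "finite X" "2 \<le> k" "2 * k \<le> card X" "partition_on (johnson_edges X k) P" "2 \<le> card P"
    by fact+
  show "act g ` D \<in> P" if g: "g permutes X" and D: "D \<in> P" for g D
  proof -
    have "restrict g X \<in> carrier (BijGroup X)"
      using permutes_imp_bij[OF g] by (auto simp: BijGroup_def Bij_def bij_betw_restrict_eq)
    then have "part_action P (restrict g X) D \<in> P"
      using group_action.element_image[OF GA _ D] by blast
    moreover have "part_action P (restrict g X) D = act g ` D"
      by (rule part_act[OF D]) simp
    ultimately show ?thesis
      by simp
  qed
  show "\<B> = {P} \<or> \<B> = (\<lambda>D. {D}) ` P"
    if \<B>: "partition_on P \<B>"
      and inv: "\<And>g B. g permutes X \<Longrightarrow> B \<in> \<B> \<Longrightarrow> (`) (act g) ` B \<in> \<B>" for \<B>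
  proof -
    have "part_action P g ` B \<in> \<B>" if g: "g \<in> carrier (BijGroup X)" and B: "B \<in> \<B>" for g B
    proof -
      let ?h = "\<lambda>x. if x \<in> X then g x else x"
      have "bij_betw g X X"
        using g by (simp add: BijGroup_def Bij_def)
      then have "bij_betw ?h X X"
        by (rule bij_betw_cong[THEN iffD1, rotated]) simp
      then have h: "?h permutes X"
        by (rule bij_imp_permutes) simp
      have "part_action P g ` B = (`) (act ?h) ` B"
        using B \<B> by (intro image_cong part_act) (auto simp: partition_on_def)
      then show ?thesis
        using inv[OF h B] by simp
    qed
    then show ?thesis
      using prim \<B> unfolding primitive_action_def by blast
  qed
qed

section \<open>The parts of the standard decompositions\<close>

text \<open>A k-set containing \<open>Y\<close> has exactly one further point, so two distinct ones
  meet precisely in \<open>Y\<close>.\<close>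

lemma P_part_iff:
  assumes "Y \<in> nsets X (k - 1)" "1 \<le> k"
  shows "f \<in> P_part X k Y \<longleftrightarrow> f \<in> johnson_edges X k \<and> \<Inter> f = Y"
proof
  assume "f \<in> P_part X k Y"
  then obtain A B where AB: "f = {A, B}" "A \<noteq> B" "A \<in> nsets X k" "B \<in> nsets X k" "Y \<subseteq> A" "Y \<subseteq> B"
    by (auto simp: P_part_def elim!: nsets2_E)
  then have "card (A - Y) = 1" "card (B - Y) = 1"
    using assms by (auto simp: nsets_def card_Diff_subset)
  then obtain a b where ab: "A - Y = {a}" "B - Y = {b}"
    by (metis card_1_singletonE)
  then have eq: "A = insert a Y" "B = insert b Y"
    using AB by auto
  have mem: "a \<in> X - Y" "b \<in> X - Y" "a \<noteq> b"
    using ab AB eq by (auto simp: nsets_def)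
  then have "\<Inter> f = Y"
    using AB(1) eq by auto
  then show "f \<in> johnson_edges X k \<and> \<Inter> f = Y"
    using johnson_edgeI[OF assms(1) mem assms(2)] AB(1) eq by simp
next
  assume "f \<in> johnson_edges X k \<and> \<Inter> f = Y"
  then show "f \<in> P_part X k Y"
    unfolding P_part_def johnson_edges_def by auto
qed

text \<open>A k-subset of a (k + 1)-set is determined by the point it omits. The omitted point later
  labels the vertices of the complete graph.\<close>

lemma Q_part_eq:
  assumes "finite W" "card W = k + 1"
  shows "Q_part k W = {{W - {x}, W - {y}} | x y. x \<in> W \<and> y \<in> W \<and> x \<noteq> y}"
proof -
  have *: "A \<in> nsets W k \<longleftrightarrow> (\<exists>x\<in>W. A = W - {x})" for A
  proof
    assume "A \<in> nsets W k"
    then have A: "A \<subseteq> W" "card A = k"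
      by (auto simp: nsets_def)
    then have "card (W - A) = 1"
      using assms by (simp add: card_Diff_subset finite_subset)
    then obtain x where "W - A = {x}"
      by (metis card_1_singletonE)
    then have "x \<in> W" "A = W - {x}"
      using A by auto
    then show "\<exists>x\<in>W. A = W - {x}"
      by blast
  next
    assume "\<exists>x\<in>W. A = W - {x}"
    then show "A \<in> nsets W k"
      using assms by (auto simp: nsets_def)
  qed
  show ?thesis
  proof (intro Set.set_eqI iffI)
    fix f assume "f \<in> Q_part k W"
    then obtain A B where "f = {A, B}" "A \<noteq> B" "A \<in> nsets W k" "B \<in> nsets W k"
      by (auto simp: Q_part_def elim!: nsets2_E)
    then show "f \<in> {{W - {x}, W - {y}} | x y. x \<in> W \<and> y \<in> W \<and> x \<noteq> y}"
      using *[of A] *[of B] by blast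
  next
    fix f assume "f \<in> {{W - {x}, W - {y}} | x y. x \<in> W \<and> y \<in> W \<and> x \<noteq> y}"
    then obtain x y where xy: "f = {W - {x}, W - {y}}" "x \<in> W" "y \<in> W" "x \<noteq> y"
      by blast
    then have "W - {x} \<noteq> W - {y}"
      by blast
    then show "f \<in> Q_part k W"
      using xy * by (auto simp: Q_part_def)
  qed
qed

lemma Q_part_iff:
  assumes "W \<in> nsets X (k + 1)" "1 \<le> k"
  shows "f \<in> Q_part k W \<longleftrightarrow> f \<in> johnson_edges X k \<and> \<Union> f = W"
proof
  have W: "finite W" "card W = k + 1" "W \<subseteq> X"
    using assms by (auto simp: nsets_def)
  assume "f \<in> Q_part k W"
  then obtain x y where xy: "f = {W - {x}, W - {y}}" "x \<in> W" "y \<in> W" "x \<noteq> y"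
    using Q_part_eq[OF W(1,2)] by blast
  have "W - {x} = insert y (W - {x, y})" "W - {y} = insert x (W - {x, y})"
    using xy by auto
  moreover have "W - {x, y} \<in> nsets X (k - 1)"
    using xy W by (auto simp: nsets_def card_Diff_subset)
  ultimately have "f \<in> johnson_edges X k"
    using johnson_edgeI[of "W - {x, y}" X k y x] xy W assms(2) by auto
  moreover have "\<Union> f = W"
    using xy by auto
  ultimately show "f \<in> johnson_edges X k \<and> \<Union> f = W" ..
next
  assume f: "f \<in> johnson_edges X k \<and> \<Union> f = W"
  then obtain A B where AB: "f = {A, B}" "A \<in> nsets X k" "B \<in> nsets X k" "A \<noteq> B"
    by (auto simp: johnson_edges_def)
  then have "A \<in> nsets W k" "B \<in> nsets W k"
    using f by (auto simp: nsets_def)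
  then show "f \<in> Q_part k W"
    using AB by (simp add: Q_part_def)
qed

lemma M_part_iff:
  assumes "a \<in> X" "b \<in> X" "a \<noteq> b" "1 \<le> k"
  shows "f \<in> M_part X k a b \<longleftrightarrow> f \<in> johnson_edges X k \<and> \<Union> f - \<Inter> f = {a, b}"
proof
  assume "f \<in> M_part X k a b"
  then obtain Y where Y: "f = {insert a Y, insert b Y}" "Y \<in> nsets (X - {a, b}) (k - 1)"
    by (auto simp: M_part_def)
  then have "Y \<in> nsets X (k - 1)" "a \<notin> Y" "b \<notin> Y"
    by (auto simp: nsets_def)
  then show "f \<in> johnson_edges X k \<and> \<Union> f - \<Inter> f = {a, b}"
    using johnson_edgeI[of Y X k a b] assms Y(1) by auto
next
  assume f: "f \<in> johnson_edges X k \<and> \<Union> f - \<Inter> f = {a, b}"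
  then obtain Y c d where *: "Y \<in> nsets X (k - 1)" "c \<in> X - Y" "d \<in> X - Y"
    "f = {insert c Y, insert d Y}" "\<Union> f - \<Inter> f = {c, d}"
    using assms(4) by (elim conjE johnson_edgeE) auto
  then have cd: "c = a \<and> d = b \<or> c = b \<and> d = a"
    using f by (auto simp: doubleton_eq_iff)
  have "Y \<in> nsets (X - {a, b}) (k - 1)" "f = {{a} \<union> Y, {b} \<union> Y}"
    using * cd by (auto simp: nsets_def)
  then show "f \<in> M_part X k a b"
    unfolding M_part_def by blast
qed

lemma obtain_two_elements:
  assumes "2 \<le> card A"
  obtains a b where "a \<in> A" "b \<in> A" "a \<noteq> b"
proof -
  obtain B where "B \<subseteq> A" "card B = 2"
    using obtain_subset_with_card_n[OF assms] by metis
  then show thesis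
    using that by (auto simp: card_2_iff)
qed

section \<open>The standard decompositions as fibres of maps on edges\<close>

context
  fixes X :: "'a set" and k :: nat
  assumes finite_X: "finite X" and k_ge_1: "1 \<le> k" and card_X: "k + 1 \<le> card X"
begin

lemma johnson_edge_with_Inter:
  assumes "Y \<in> nsets X (k - 1)"
  obtains e where "e \<in> johnson_edges X k" "\<Inter> e = Y"
proof -
  have "2 \<le> card (X - Y)"
    using assms card_X k_ge_1 by (auto simp: nsets_def card_Diff_subset)
  then obtain a b where ab: "a \<in> X - Y" "b \<in> X - Y" "a \<noteq> b"
    by (rule obtain_two_elements)
  show thesis
    using johnson_edgeI[OF assms ab k_ge_1] by (rule that) (use ab in auto)
qed

lemma johnson_edge_with_Union:
  assumes "W \<in> nsets X (k + 1)"
  obtains e where "e \<in> johnson_edges X k" "\<Union> e = W"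
proof -
  have "2 \<le> card W"
    using assms k_ge_1 by (auto simp: nsets_def)
  then obtain a b where ab: "a \<in> W" "b \<in> W" "a \<noteq> b"
    by (rule obtain_two_elements)
  moreover have "finite W" "card W = k + 1"
    using assms by (auto simp: nsets_def)
  ultimately have "{W - {a}, W - {b}} \<in> Q_part k W"
    using Q_part_eq by blast
  then have "{W - {a}, W - {b}} \<in> johnson_edges X k \<and> \<Union> {W - {a}, W - {b}} = W"
    by (rule Q_part_iff[OF assms k_ge_1, THEN iffD1])
  then show thesis
    using that by blast
qed

lemma johnson_edge_with_diff:
  assumes "a \<in> X" "b \<in> X" "a \<noteq> b"
  obtains e where "e \<in> johnson_edges X k" "\<Union> e - \<Inter> e = {a, b}"
proof -
  have "k - 1 \<le> card (X - {a, b})"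
    using assms card_X by (simp add: card_Diff_subset)
  then obtain Y where Y: "Y \<subseteq> X - {a, b}" "card Y = k - 1" "finite Y"
    using obtain_subset_with_card_n by metis
  then have "Y \<in> nsets X (k - 1)"
    by (auto simp: nsets_def)
  then show thesis
    using johnson_edgeI[of Y X k a b] that[of "{insert a Y, insert b Y}"] assms Y k_ge_1 by auto
qed

text \<open>Indexing by edges gives the shape that \<open>parts_eq_fibres\<close> produces. It loses
  no part, since every (k - 1)-subset is the intersection of some edge.\<close>

lemma P_cap_eq: "P_cap X k = (\<lambda>e. {f \<in> johnson_edges X k. \<Inter> f = \<Inter> e}) ` johnson_edges X k"
proof -
  have "P_part X k Y = {f \<in> johnson_edges X k. \<Inter> f = Y}" if "Y \<in> nsets X (k - 1)" for Y
    using P_part_iff[OF that k_ge_1] by blast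
  then have "P_cap X k = (\<lambda>Y. {f \<in> johnson_edges X k. \<Inter> f = Y}) ` nsets X (k - 1)"
    unfolding P_cap_def setcompr_eq_image by (intro image_cong) auto
  also have "nsets X (k - 1) = Inter ` johnson_edges X k"
  proof (intro equalityI subsetI)
    fix Y assume "Y \<in> nsets X (k - 1)"
    then show "Y \<in> Inter ` johnson_edges X k"
      using johnson_edge_with_Inter by blast
  next
    fix Y assume "Y \<in> Inter ` johnson_edges X k"
    then obtain e where "e \<in> johnson_edges X k" "Y = \<Inter> e"
      by blast
    then show "Y \<in> nsets X (k - 1)"
      using k_ge_1 by (elim johnson_edgeE) simp_all
  qed
  finally show ?thesis
    by (simp add: image_image)
qed

text \<open>Every (k + 1)-subset is the union of some edge. When |X| = 2k + 2 the complement of such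
  a set is another one, so \<open>Q_part k (X - W)\<close> is a fibre of the union as well.\<close>

lemma P_cup_eq: "P_cup X k = (\<lambda>e. {f \<in> johnson_edges X k. \<Union> f = \<Union> e}) ` johnson_edges X k"
  and Q_pairs_eq: "card X = 2 * k + 2 \<Longrightarrow> Q_pairs X k =
    (\<lambda>e. {f \<in> johnson_edges X k. \<Union> f = \<Union> e \<or> \<Union> f = X - \<Union> e}) ` johnson_edges X k"
proof -
  have Q: "Q_part k W = {f \<in> johnson_edges X k. \<Union> f = W}" if "W \<in> nsets X (k + 1)" for W
    using Q_part_iff[OF that k_ge_1] by blast
  have W: "nsets X (k + 1) = Union ` johnson_edges X k"
  proof (intro equalityI subsetI)
    fix W assume "W \<in> nsets X (k + 1)"
    then show "W \<in> Union ` johnson_edges X k"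
      using johnson_edge_with_Union by blast
  next
    fix W assume "W \<in> Union ` johnson_edges X k"
    then obtain e where "e \<in> johnson_edges X k" "W = \<Union> e"
      by blast
    then show "W \<in> nsets X (k + 1)"
      using johnson_edge_cards(2,4)[OF _ k_ge_1 finite_X] finite_X
      by (auto simp: nsets_def intro: finite_subset)
  qed
  have "P_cup X k = (\<lambda>W. {f \<in> johnson_edges X k. \<Union> f = W}) ` nsets X (k + 1)"
    unfolding P_cup_def setcompr_eq_image using Q by (intro image_cong) auto
  then show "P_cup X k = (\<lambda>e. {f \<in> johnson_edges X k. \<Union> f = \<Union> e}) ` johnson_edges X k"
    unfolding W by (simp add: image_image)
  assume c: "card X = 2 * k + 2"
  have "Q_part k W \<union> Q_part k (X - W) = {f \<in> johnson_edges X k. \<Union> f = W \<or> \<Union> f = X - W}"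
    if "W \<in> nsets X (k + 1)" for W
  proof -
    have "X - W \<in> nsets X (k + 1)"
      using that c finite_X by (auto simp: nsets_def card_Diff_subset)
    then show ?thesis
      using Q that by blast
  qed
  then have "Q_pairs X k = (\<lambda>W. {f \<in> johnson_edges X k. \<Union> f = W \<or> \<Union> f = X - W}) ` nsets X (k + 1)"
    unfolding Q_pairs_def setcompr_eq_image by (intro image_cong) auto
  then show "Q_pairs X k =
    (\<lambda>e. {f \<in> johnson_edges X k. \<Union> f = \<Union> e \<or> \<Union> f = X - \<Union> e}) ` johnson_edges X k"
    unfolding W by (simp add: image_image)
qed

lemma P_ominus_eq: "P_ominus X k =
  (\<lambda>e. {f \<in> johnson_edges X k. \<Union> f - \<Inter> f = \<Union> e - \<Inter> e}) ` johnson_edges X k"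
proof -
  have M: "M_part X k a b = {f \<in> johnson_edges X k. \<Union> f - \<Inter> f = {a, b}}"
    if "a \<in> X" "b \<in> X" "a \<noteq> b" for a b
    using M_part_iff[OF that k_ge_1] by blast
  show ?thesis
  proof (intro equalityI subsetI)
    fix D assume "D \<in> P_ominus X k"
    then obtain a b where ab: "a \<in> X" "b \<in> X" "a \<noteq> b" "D = M_part X k a b"
      by (auto simp: P_ominus_def)
    then obtain e where e: "e \<in> johnson_edges X k" "\<Union> e - \<Inter> e = {a, b}"
      using johnson_edge_with_diff by blast
    then have "D = {f \<in> johnson_edges X k. \<Union> f - \<Inter> f = \<Union> e - \<Inter> e}"
      using M ab by simp
    with e(1) show "D \<in> (\<lambda>e. {f \<in> johnson_edges X k. \<Union> f - \<Inter> f = \<Union> e - \<Inter> e}) ` johnson_edges X k"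
      by blast
  next
    fix D assume "D \<in> (\<lambda>e. {f \<in> johnson_edges X k. \<Union> f - \<Inter> f = \<Union> e - \<Inter> e}) ` johnson_edges X k"
    then obtain e where e: "e \<in> johnson_edges X k"
      "D = {f \<in> johnson_edges X k. \<Union> f - \<Inter> f = \<Union> e - \<Inter> e}"
      by blast
    then obtain a b where ab: "a \<in> X" "b \<in> X" "a \<noteq> b" "\<Union> e - \<Inter> e = {a, b}"
      using k_ge_1 by (elim johnson_edgeE) auto
    then have "D = M_part X k a b"
      using M e by simp
    then show "D \<in> P_ominus X k"
      unfolding P_ominus_def using ab by blast
  qed
qed

end

section \<open>Isomorphism types of the divisors: copies of complete graphs\<close>

lemma graph_isoI:
  assumes "inj_on g (\<Union> F)" "(`) g ` F = E"
  shows "graph_iso E F"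
proof -
  \<comment> \<open>The model \<open>F\<close> has numbered vertices, so a map out of it is easy to
    write down; \<open>graph_iso\<close> wants the opposite direction.\<close>
  let ?f = "inv_into (\<Union> F) g"
  have E: "\<Union> E = g ` \<Union> F"
    using assms(2) by blast
  have "bij_betw ?f (\<Union> E) (\<Union> F)"
    unfolding E by (rule bij_betw_inv_into) (simp add: assms(1) bij_betw_def)
  moreover have "(`) ?f ` E = F"
  proof -
    have "?f ` g ` e = e" if "e \<in> F" for e
      using assms(1) that by (intro inv_into_image_cancel) auto
    then show ?thesis
      unfolding assms(2)[symmetric] by (simp add: image_image cong: image_cong)
  qed
  ultimately show ?thesis
    unfolding graph_iso_def by blast
qed

lemma complete_image:
  assumes "bij_betw \<alpha> {..<m} A"
  shows "{{h (\<alpha> u), h (\<alpha> v)} | u v. u < m \<and> v < m \<and> u \<noteq> v} = {{h x, h y} | x y. x \<in> A \<and> y \<in> A \<and> x \<noteq> y}"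
proof (intro Set.set_eqI iffI)
  fix e assume "e \<in> {{h (\<alpha> u), h (\<alpha> v)} | u v. u < m \<and> v < m \<and> u \<noteq> v}"
  then obtain u v where uv: "e = {h (\<alpha> u), h (\<alpha> v)}" "u < m" "v < m" "u \<noteq> v"
    by blast
  then have "\<alpha> u \<in> A" "\<alpha> v \<in> A" "\<alpha> u \<noteq> \<alpha> v"
    using assms unfolding bij_betw_def inj_on_def by auto
  then show "e \<in> {{h x, h y} | x y. x \<in> A \<and> y \<in> A \<and> x \<noteq> y}"
    using uv by blast
next
  fix e assume "e \<in> {{h x, h y} | x y. x \<in> A \<and> y \<in> A \<and> x \<noteq> y}"
  then obtain x y where xy: "e = {h x, h y}" "x \<in> A" "y \<in> A" "x \<noteq> y"
    by blast
  then obtain u v where "u < m" "x = \<alpha> u" "v < m" "y = \<alpha> v"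
    using assms unfolding bij_betw_def by blast
  then show "e \<in> {{h (\<alpha> u), h (\<alpha> v)} | u v. u < m \<and> v < m \<and> u \<noteq> v}"
    using xy by blast
qed

text \<open>Here \<open>h i x\<close> is the vertex of copy \<open>i\<close> labelled by
  \<open>x\<close> in \<open>A i\<close>, and \<open>\<alpha> i\<close> numbers the labels. Joint
  injectivity of \<open>h\<close> in both arguments makes the copies vertex-disjoint as well as
  faithful.\<close>

lemma graph_iso_copies_complete:
  assumes "\<And>i. i < r \<Longrightarrow> bij_betw (\<alpha> i) {..<m} (A i)"
    and "\<And>i j x y. i < r \<Longrightarrow> j < r \<Longrightarrow> x \<in> A i \<Longrightarrow> y \<in> A j \<Longrightarrow> h i x = h j y \<Longrightarrow> i = j \<and> x = y"
  shows "graph_iso (\<Union>i<r. {{h i x, h i y} | x y. x \<in> A i \<and> y \<in> A i \<and> x \<noteq> y}) (copies_complete r m)"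
proof (rule graph_isoI)
  let ?g = "\<lambda>(i, u). h i (\<alpha> i u)"
  have sub: "\<Union> (copies_complete r m) \<subseteq> {..<r} \<times> {..<m}"
    by (auto simp: copies_complete_def)
  have "inj_on ?g ({..<r} \<times> {..<m})"
  proof (rule inj_onI)
    fix p q assume "p \<in> {..<r} \<times> {..<m}" "q \<in> {..<r} \<times> {..<m}" "?g p = ?g q"
    then obtain i u j v where *: "p = (i, u)" "q = (j, v)" "i < r" "j < r" "u < m" "v < m"
      "h i (\<alpha> i u) = h j (\<alpha> j v)"
      by auto
    have "\<alpha> i u \<in> A i" "\<alpha> j v \<in> A j"
      using * assms(1)[of i] assms(1)[of j] by (auto simp: bij_betw_def)
    then have "i = j" "\<alpha> i u = \<alpha> j v"
      using assms(2)[OF *(3,4)] *(7) by blast+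
    then show "p = q"
      using * assms(1)[of i] by (auto simp: bij_betw_def inj_on_def)
  qed
  then show "inj_on ?g (\<Union> (copies_complete r m))"
    using sub by (rule inj_on_subset)
  have "copies_complete r m = (\<Union>i<r. {{(i, u), (i, v)} | u v. u < m \<and> v < m \<and> u \<noteq> v})"
    by (auto simp: copies_complete_def)
  then have "(`) ?g ` copies_complete r m
      = (\<Union>i<r. (`) ?g ` {{(i, u), (i, v)} | u v. u < m \<and> v < m \<and> u \<noteq> v})"
    by (simp add: image_UN)
  also have "\<dots> = (\<Union>i<r. {{h i (\<alpha> i u), h i (\<alpha> i v)} | u v. u < m \<and> v < m \<and> u \<noteq> v})"
  proof (intro SUP_cong refl)
    fix i
    show "(`) ?g ` {{(i, u), (i, v)} | u v. u < m \<and> v < m \<and> u \<noteq> v}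
      = {{h i (\<alpha> i u), h i (\<alpha> i v)} | u v. u < m \<and> v < m \<and> u \<noteq> v}" (is "?L = ?R")
    proof (intro equalityI subsetI)
      fix e assume "e \<in> ?L"
      then obtain u v where "u < m" "v < m" "u \<noteq> v" "e = ?g ` {(i, u), (i, v)}"
        by blast
      then show "e \<in> ?R"
        by auto
    next
      fix e assume "e \<in> ?R"
      then obtain u v where uv: "u < m" "v < m" "u \<noteq> v" "e = {h i (\<alpha> i u), h i (\<alpha> i v)}"
        by blast
      then have "e = ?g ` {(i, u), (i, v)}"
        by simp
      with uv(1-3) show "e \<in> ?L"
        by blast
    qed
  qed
  also have "\<dots> = (\<Union>i<r. {{h i x, h i y} | x y. x \<in> A i \<and> y \<in> A i \<and> x \<noteq> y})"
    by (intro SUP_cong refl complete_image assms(1)) simp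
  finally show "(`) ?g ` copies_complete r m
    = (\<Union>i<r. {{h i x, h i y} | x y. x \<in> A i \<and> y \<in> A i \<and> x \<noteq> y})" .
qed

text \<open>The two copies live on \<open>W\<close> and on its complement, a vertex being labelled
  by the point that it omits.\<close>

lemma graph_iso_Q_pair:
  assumes "finite X" "card X = 2 * k + 2" "1 \<le> k" "W \<in> nsets X (k + 1)"
  shows "graph_iso (Q_part k W \<union> Q_part k (X - W)) (copies_complete 2 (k + 1))"
proof -
  define A where "A i = (if i = 0 then W else X - W)" for i :: nat
  have W: "W \<subseteq> X" "finite W" "card W = k + 1" "finite (X - W)" "card (X - W) = k + 1"
    using assms by (auto simp: nsets_def card_Diff_subset)
  have A: "finite (A i)" "card (A i) = k + 1" for i
    using W by (auto simp: A_def)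
  have "\<exists>f. bij_betw f {..<k + 1} (A i)" for i
    using finite_same_card_bij[of "{..<k + 1}" "A i"] A by simp
  then obtain \<alpha> where \<alpha>: "\<And>i. bij_betw (\<alpha> i) {..<k + 1} (A i)"
    by metis
  have inj: "i = j \<and> x = y"
    if "i < 2" "j < 2" "x \<in> A i" "y \<in> A j" "A i - {x} = A j - {y}" for i j :: nat and x y
  proof (cases "i = j")
    case True
    then show ?thesis
      using that by blast
  next
    case False
    \<comment> \<open>A vertex common to both copies would lie in two disjoint sets and be empty,
      but it has k > 0 points.\<close>
    then have "A i \<inter> A j = {}"
      using that(1,2) by (auto simp: A_def)
    then have "A i - {x} = {}"
      using that(5) by blast
    moreover have "card (A i - {x}) = k"
      using A that(3) by simp
    ultimately have "k = 0"
      by (metis card.empty)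
    then show ?thesis
      using assms(3) by simp
  qed
  have "{..<2} = {0, 1::nat}"
    by auto
  then have "Q_part k W \<union> Q_part k (X - W)
      = (\<Union>i<2. {{A i - {x}, A i - {y}} | x y. x \<in> A i \<and> y \<in> A i \<and> x \<noteq> y})"
    using W by (simp add: Q_part_eq A_def)
  then show ?thesis
    using graph_iso_copies_complete[of 2 \<alpha> "k + 1" A "\<lambda>i x. A i - {x}"] \<alpha> inj by simp
qed

section \<open>Six points: partitions into three pairs\<close>

lemma pair_partitions_3_iff:
  assumes "finite X" "card X = 6"
  shows "\<pi> \<in> pair_partitions X 3 \<longleftrightarrow>
    (\<exists>p q. p \<in> nsets X 2 \<and> q \<in> nsets X 2 \<and> p \<inter> q = {} \<and> \<pi> = {p, q, X - (p \<union> q)})"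
proof
  assume "\<pi> \<in> pair_partitions X 3"
  then have \<pi>: "partition_on X \<pi>" "card \<pi> = 3" "\<And>p. p \<in> \<pi> \<Longrightarrow> card p = 2"
    by (auto simp: pair_partitions_def)
  then obtain p q r where pqr: "\<pi> = {p, q, r}" "p \<noteq> q" "p \<noteq> r" "q \<noteq> r"
    unfolding card_3_iff by metis
  have disj: "p \<inter> q = {}" "p \<inter> r = {}" "q \<inter> r = {}"
    by (intro disjointD[OF partition_onD2[OF \<pi>(1)]]; simp add: pqr)+
  have "p \<union> q \<union> r = X"
    using \<pi>(1) pqr(1) by (auto simp: partition_on_def)
  then have "r = X - (p \<union> q)" "p \<subseteq> X" "q \<subseteq> X"
    using disj by blast+
  moreover have "p \<in> nsets X 2" "q \<in> nsets X 2"
    using \<pi>(3) pqr(1) assms(1) calculation by (auto simp: nsets_def intro: finite_subset)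
  ultimately show "\<exists>p q. p \<in> nsets X 2 \<and> q \<in> nsets X 2 \<and> p \<inter> q = {} \<and> \<pi> = {p, q, X - (p \<union> q)}"
    using pqr(1) disj(1) by blast
next
  assume "\<exists>p q. p \<in> nsets X 2 \<and> q \<in> nsets X 2 \<and> p \<inter> q = {} \<and> \<pi> = {p, q, X - (p \<union> q)}"
  then obtain p q where pq: "p \<subseteq> X" "q \<subseteq> X" "finite p" "finite q" "card p = 2" "card q = 2"
    "p \<inter> q = {}" "\<pi> = {p, q, X - (p \<union> q)}"
    by (auto simp: nsets_def)
  let ?r = "X - (p \<union> q)"
  have r: "card ?r = 2"
    using pq assms by (subst card_Diff_subset) (auto simp: card_Un_disjoint)
  have ne: "p \<noteq> {}" "q \<noteq> {}" "?r \<noteq> {}"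
    using pq(5,6) r by (metis card.empty zero_neq_numeral)+
  then have dist: "p \<noteq> q" "p \<noteq> ?r" "q \<noteq> ?r"
    using pq(7) by blast+
  have "partition_on X \<pi>"
  proof (rule partition_onI)
    show "\<Union> \<pi> = X"
      using pq by auto
    show "{} \<notin> \<pi>"
      using ne pq(8) by simp
    show "disjnt a b" if "a \<in> \<pi>" "b \<in> \<pi>" "a \<noteq> b" for a b
      using that pq(7,8) unfolding disjnt_def by blast
  qed
  then show "\<pi> \<in> pair_partitions X 3"
    using pq(5,6,8) r dist by (simp add: pair_partitions_def)
qed

lemma pi_part_iff:
  "f \<in> pi_part X \<pi> \<longleftrightarrow> f \<in> johnson_edges X 3 \<and> \<Union> f - \<Inter> f \<in> \<pi> \<and> \<Inter> f \<in> \<pi>"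
proof -
  have eq: "sym_diff A B = \<Union> {A, B} - \<Inter> {A, B}" "A \<inter> B = \<Inter> {A, B}" for A B :: "'a set"
    by auto
  have "f \<in> pi_part X \<pi> \<longleftrightarrow> (\<exists>A B. f = {A, B}) \<and> f \<in> johnson_edges X 3 \<and> \<Union> f - \<Inter> f \<in> \<pi> \<and> \<Inter> f \<in> \<pi>"
    unfolding pi_part_def eq by blast
  moreover have "\<exists>A B. f = {A, B}" if "f \<in> johnson_edges X 3"
    using that by (auto simp: johnson_edges_def)
  ultimately show ?thesis
    by blast
qed

text \<open>Two distinct members of a partition into three pairs determine the third as the
  complement of their union. So once the common points and the ends of an edge belong to
  \<open>\<pi>\<close>, its three cells make up all of \<open>\<pi>\<close>.\<close>

lemma pi_part_eq:
  assumes "finite X" "card X = 6" "\<pi> \<in> pair_partitions X 3"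
  shows "pi_part X \<pi> = {f \<in> johnson_edges X 3. {\<Inter> f, \<Union> f - \<Inter> f, X - \<Union> f} = \<pi>}"
proof -
  obtain p q where pq: "p \<in> nsets X 2" "q \<in> nsets X 2" "p \<inter> q = {}" "\<pi> = {p, q, X - (p \<union> q)}"
    using pair_partitions_3_iff[OF assms(1,2), THEN iffD1, OF assms(3)] by blast
  have sub: "p \<subseteq> X" "q \<subseteq> X"
    using pq by (auto simp: nsets_def)
  have third: "{u, v, X - (u \<union> v)} = \<pi>" if "u \<in> \<pi>" "v \<in> \<pi>" "u \<noteq> v" for u v
  proof -
    define r where "r = X - (p \<union> q)"
    have compl: "X - (p \<union> q) = r" "X - (q \<union> p) = r" "X - (p \<union> r) = q" "X - (r \<union> p) = q"
      "X - (q \<union> r) = p" "X - (r \<union> q) = p"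
      unfolding r_def using sub pq(3) by blast+
    have \<pi>: "\<pi> = {p, q, r}"
      unfolding pq(4) r_def ..
    show ?thesis
      using that unfolding \<pi> by (elim insertE emptyE) (simp_all add: compl insert_commute)
  qed
  have "{\<Inter> f, \<Union> f - \<Inter> f, X - \<Union> f} = \<pi> \<longleftrightarrow> \<Union> f - \<Inter> f \<in> \<pi> \<and> \<Inter> f \<in> \<pi>"
    if f: "f \<in> johnson_edges X 3" for f
  proof
    assume *: "\<Union> f - \<Inter> f \<in> \<pi> \<and> \<Inter> f \<in> \<pi>"
    note c = johnson_edge_cards[OF f _ assms(1), simplified]
    have "\<Inter> f \<union> (\<Union> f - \<Inter> f) = \<Union> f"
      using c(1) by blast
    moreover have "\<Inter> f \<noteq> {}"
      using c(3) by auto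
    then have "\<Inter> f \<noteq> \<Union> f - \<Inter> f"
      by blast
    ultimately show "{\<Inter> f, \<Union> f - \<Inter> f, X - \<Union> f} = \<pi>"
      using third[OF conjunct2[OF *] conjunct1[OF *]] by metis
  qed blast
  then have "f \<in> pi_part X \<pi> \<longleftrightarrow>
      f \<in> johnson_edges X 3 \<and> {\<Inter> f, \<Union> f - \<Inter> f, X - \<Union> f} = \<pi>" for f
    by (metis pi_part_iff)
  then show ?thesis
    by (intro Set.set_eqI) simp
qed

lemma pi_parts_eq:
  assumes "finite X" "card X = 6"
  shows "pi_parts X = (\<lambda>e. {f \<in> johnson_edges X 3. {\<Inter> f, \<Union> f - \<Inter> f, X - \<Union> f}
    = {\<Inter> e, \<Union> e - \<Inter> e, X - \<Union> e}}) ` johnson_edges X 3"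
proof -
  have "pi_parts X = (\<lambda>\<pi>. {f \<in> johnson_edges X 3. {\<Inter> f, \<Union> f - \<Inter> f, X - \<Union> f} = \<pi>})
      ` pair_partitions X 3"
    unfolding pi_parts_def setcompr_eq_image using pi_part_eq[OF assms] by (intro image_cong) auto
  also have "pair_partitions X 3 = (\<lambda>e. {\<Inter> e, \<Union> e - \<Inter> e, X - \<Union> e}) ` johnson_edges X 3"
  proof (intro equalityI subsetI)
    fix \<pi> assume \<pi>: "\<pi> \<in> pair_partitions X 3"
    obtain p q where pq: "p \<in> nsets X 2" "q \<in> nsets X 2" "p \<inter> q = {}" "\<pi> = {p, q, X - (p \<union> q)}"
      using pair_partitions_3_iff[OF assms, THEN iffD1, OF \<pi>] by blast
    obtain a b where ab: "q = {a, b}" "a \<in> X" "b \<in> X" "a \<noteq> b"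
      using pq(2) by (auto elim: nsets2_E)
    \<comment> \<open>The edge with common points \<open>p\<close> and ends \<open>q\<close>; its
      outside cell is then the remaining pair.\<close>
    define e where "e = {insert a p, insert b p}"
    have e: "e \<in> johnson_edges X 3"
      using johnson_edgeI[of p X 3 a b] pq ab by (auto simp: e_def)
    have "\<Inter> e = p" "\<Union> e = p \<union> q"
      using pq(3) ab by (auto simp: e_def)
    moreover have "p \<union> q - p = q"
      using pq(3) by blast
    ultimately have "\<pi> = {\<Inter> e, \<Union> e - \<Inter> e, X - \<Union> e}"
      unfolding pq(4) by simp
    with e show "\<pi> \<in> (\<lambda>e. {\<Inter> e, \<Union> e - \<Inter> e, X - \<Union> e}) ` johnson_edges X 3"
      by blast
  next
    fix \<pi> assume "\<pi> \<in> (\<lambda>e. {\<Inter> e, \<Union> e - \<Inter> e, X - \<Union> e}) ` johnson_edges X 3"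
    then obtain e where e: "e \<in> johnson_edges X 3" "\<pi> = {\<Inter> e, \<Union> e - \<Inter> e, X - \<Union> e}"
      by blast
    note c = johnson_edge_cards[OF e(1) _ assms(1), simplified]
    have un: "\<Inter> e \<union> (\<Union> e - \<Inter> e) = \<Union> e"
      using c(1) by blast
    have mem: "\<Inter> e \<in> nsets X 2" "\<Union> e - \<Inter> e \<in> nsets X 2"
      using c finite_subset[OF _ assms(1)] by (auto simp: nsets_def)
    show "\<pi> \<in> pair_partitions X 3"
      unfolding pair_partitions_3_iff[OF assms]
    proof (intro exI conjI)
      show "\<pi> = {\<Inter> e, \<Union> e - \<Inter> e, X - (\<Inter> e \<union> (\<Union> e - \<Inter> e))}"
        unfolding un by (rule e(2))
    qed (rule mem Diff_disjoint)+
  qed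
  finally show ?thesis
    by (simp add: image_image)
qed

text \<open>An edge of the part corresponds to an ordered pair of distinct members of
  \<open>\<pi>\<close>: \<open>c\<close> for the common points and \<open>s\<close> for the ends.
  Each such edge is written as a complete graph on the two labels in \<open>s\<close>, to fit
  \<open>graph_iso_copies_complete\<close>.\<close>

lemma pi_part_Union:
  assumes "finite X" "card X = 6" "\<pi> \<in> pair_partitions X 3"
  shows "pi_part X \<pi> = (\<Union>(c, s)\<in>{(c, s). c \<in> \<pi> \<and> s \<in> \<pi> \<and> c \<noteq> s}.
    {{insert x c, insert y c} | x y. x \<in> s \<and> y \<in> s \<and> x \<noteq> y})" (is "_ = ?R")
proof -
  have \<pi>: "\<And>p. p \<in> \<pi> \<Longrightarrow> card p = 2" "\<And>p. p \<in> \<pi> \<Longrightarrow> p \<subseteq> X" "\<And>p q. p \<in> \<pi> \<Longrightarrow> q \<in> \<pi> \<Longrightarrow> p \<noteq> q \<Longrightarrow> p \<inter> q = {}"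
    using assms(3) by (auto simp: pair_partitions_def partition_on_def disjoint_def)
  show ?thesis
  proof (intro equalityI subsetI)
    fix f assume "f \<in> pi_part X \<pi>"
    then have f: "f \<in> johnson_edges X 3" "\<Union> f - \<Inter> f \<in> \<pi>" "\<Inter> f \<in> \<pi>"
      by (auto simp: pi_part_iff)
    then obtain a b where ab: "a \<noteq> b" "f = {insert a (\<Inter> f), insert b (\<Inter> f)}"
      "\<Union> f - \<Inter> f = {a, b}"
      by (elim johnson_edgeE) auto
    have "f \<in> {{insert x (\<Inter> f), insert y (\<Inter> f)} | x y. x \<in> {a, b} \<and> y \<in> {a, b} \<and> x \<noteq> y}"
      using ab(1,2) by blast
    moreover have "\<Inter> f \<noteq> {a, b}"
      using ab(3) by blast
    ultimately show "f \<in> ?R"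
      using f ab(3) by (intro UN_I[of "(\<Inter> f, {a, b})"]) auto
  next
    fix f assume "f \<in> ?R"
    then obtain c s x y where *: "c \<in> \<pi>" "s \<in> \<pi>" "c \<noteq> s" "x \<in> s" "y \<in> s" "x \<noteq> y"
      "f = {insert x c, insert y c}"
      by auto
    have s: "s = {x, y}"
      using \<pi>(1)[OF *(2)] * by (auto simp: card_2_iff)
    have disj: "c \<inter> s = {}"
      using \<pi>(3) * by blast
    have c: "c \<in> nsets X 2"
      using \<pi>(1,2)[OF *(1)] finite_subset[OF _ assms(1)] by (simp add: nsets_def)
    have "f \<in> johnson_edges X 3"
      using johnson_edgeI[of c X 3 x y] * c disj \<pi>(2)[OF *(2)] by auto
    moreover have "\<Inter> f = c" "\<Union> f - \<Inter> f = s"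
      using * s disj by auto
    ultimately show "f \<in> pi_part X \<pi>"
      using * by (simp add: pi_part_iff)
  qed
qed

lemma graph_iso_pi_part:
  assumes "finite X" "card X = 6" "\<pi> \<in> pair_partitions X 3"
  shows "graph_iso (pi_part X \<pi>) (copies_complete 6 2)"
proof -
  have \<pi>: "card \<pi> = 3" "finite \<pi>" "\<And>p. p \<in> \<pi> \<Longrightarrow> card p = 2"
    "\<And>p q. p \<in> \<pi> \<Longrightarrow> q \<in> \<pi> \<Longrightarrow> p \<noteq> q \<Longrightarrow> p \<inter> q = {}"
    using assms(3) by (auto simp: pair_partitions_def partition_on_def disjoint_def)
  let ?T = "{(c, s). c \<in> \<pi> \<and> s \<in> \<pi> \<and> c \<noteq> s}"
  \<comment> \<open>The 6 copies come from 3 * 3 - 3 ordered pairs of distinct members.\<close>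
  have "?T = \<pi> \<times> \<pi> - (\<lambda>c. (c, c)) ` \<pi>"
    by auto
  moreover have "card ((\<lambda>c. (c, c)) ` \<pi>) = 3"
    using \<pi>(1) by (subst card_image) (auto simp: inj_on_def)
  ultimately have "card ?T = 6" "finite ?T"
    using \<pi>(1,2) by (simp_all, subst card_Diff_subset) (auto simp: card_cartesian_product)
  then obtain t where t: "bij_betw t {..<6::nat} ?T"
    using finite_same_card_bij[of "{..<6::nat}" ?T] by auto
  have tD: "fst (t i) \<in> \<pi>" "snd (t i) \<in> \<pi>" "fst (t i) \<noteq> snd (t i)" if "i < 6" for i
    using bij_betwE[OF t, THEN bspec, of i] that by (auto split: prod.splits)
  have "\<exists>f. bij_betw f {..<2::nat} (snd (t i))" if "i < 6" for i
    using finite_same_card_bij[of "{..<2::nat}" "snd (t i)"] \<pi>(3)[OF tD(2)[OF that]]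
    by (simp add: card_ge_0_finite)
  then obtain \<alpha> where \<alpha>: "\<And>i. i < 6 \<Longrightarrow> bij_betw (\<alpha> i) {..<2::nat} (snd (t i))"
    by metis
  have inj: "i = j \<and> x = y"
    if ij: "i < 6" "j < 6" and xy: "x \<in> snd (t i)" "y \<in> snd (t j)"
      and eq: "insert x (fst (t i)) = insert y (fst (t j))" for i j x y
  proof -
    have fst_eq: "fst (t i) = fst (t j)"
    proof (rule ccontr)
      \<comment> \<open>Distinct members of \<open>\<pi>\<close> are disjoint, so equal vertices
        would squeeze the two common points of edge \<open>i\<close> into
        \<open>{y}\<close>.\<close>
      assume ne: "fst (t i) \<noteq> fst (t j)"
      then have "fst (t i) \<inter> fst (t j) = {}"
        using \<pi>(4) tD ij by blast
      then have "fst (t i) \<subseteq> {y}"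
        using eq by blast
      then have "card (fst (t i)) \<le> 1"
        using card_mono[of "{y}"] by fastforce
      then show False
        using \<pi>(3)[OF tD(1)[OF ij(1)]] by simp
    qed
    have "x \<notin> fst (t i)"
      using \<pi>(4)[OF tD[OF ij(1)]] xy by blast
    then have xy_eq: "x = y"
      using eq fst_eq by blast
    then have "snd (t i) = snd (t j)"
      using \<pi>(4)[OF tD(2)[OF ij(1)] tD(2)[OF ij(2)]] xy by blast
    then have "t i = t j"
      using fst_eq by (simp add: prod_eq_iff)
    then show ?thesis
      using t ij xy_eq by (auto simp: bij_betw_def inj_on_def)
  qed
  have T: "?T = t ` {..<6}"
    using t by (simp add: bij_betw_def)
  have "pi_part X \<pi> = (\<Union>i<6. {{insert x (fst (t i)), insert y (fst (t i))} | x y.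
      x \<in> snd (t i) \<and> y \<in> snd (t i) \<and> x \<noteq> y})"
    unfolding pi_part_Union[OF assms] T by (simp add: case_prod_beta)
  then show ?thesis
    using graph_iso_copies_complete[of 6 \<alpha> 2 "\<lambda>i. snd (t i)" "\<lambda>i x. insert x (fst (t i))"] \<alpha> inj
    by simp
qed

section \<open>Four points: partitions into two pairs and the 4-cycles\<close>

lemma pair_partitions_2_iff:
  assumes "finite X" "card X = 4"
  shows "\<pi> \<in> pair_partitions X 2 \<longleftrightarrow> (\<exists>p \<in> nsets X 2. \<pi> = {p, X - p})"
proof
  assume "\<pi> \<in> pair_partitions X 2"
  then have \<pi>: "partition_on X \<pi>" "card \<pi> = 2" "\<And>p. p \<in> \<pi> \<Longrightarrow> card p = 2"
    by (auto simp: pair_partitions_def)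
  then obtain p q where pq: "\<pi> = {p, q}" "p \<noteq> q"
    by (auto simp: card_2_iff)
  have "p \<inter> q = {}" "p \<union> q = X"
    using \<pi>(1) pq by (auto simp: partition_on_def dest: disjointD)
  then have "q = X - p" "p \<subseteq> X"
    by blast+
  then show "\<exists>p \<in> nsets X 2. \<pi> = {p, X - p}"
    using pq \<pi>(3)[of p] finite_subset[OF _ assms(1)] by (auto simp: nsets_def)
next
  assume "\<exists>p \<in> nsets X 2. \<pi> = {p, X - p}"
  then obtain p where p: "p \<subseteq> X" "finite p" "card p = 2" "\<pi> = {p, X - p}"
    by (auto simp: nsets_def)
  have q: "card (X - p) = 2"
    using p assms by (simp add: card_Diff_subset)
  have ne: "p \<noteq> {}" "X - p \<noteq> {}"
    using p(3) q by (metis card.empty zero_neq_numeral)+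
  then have "p \<noteq> X - p"
    by blast
  moreover have "partition_on X \<pi>"
  proof (rule partition_onI)
    show "\<Union> \<pi> = X" "{} \<notin> \<pi>"
      using p ne by auto
    show "disjnt a b" if "a \<in> \<pi>" "b \<in> \<pi>" "a \<noteq> b" for a b
      using that unfolding p(4) disjnt_def by blast
  qed
  ultimately show "\<pi> \<in> pair_partitions X 2"
    using p(3,4) q by (simp add: pair_partitions_def)
qed

lemma pair_partitions_of_4:
  assumes "distinct [a, b, c, d]"
  shows "pair_partitions {a, b, c, d} 2 = {{{a, b}, {c, d}}, {{a, c}, {b, d}}, {{a, d}, {b, c}}}"
proof -
  have X: "finite {a, b, c, d}" "card {a, b, c, d} = 4"
    using assms by auto
  have ns: "nsets {a, b, c, d} 2 = {{a, b}, {a, c}, {a, d}, {b, c}, {b, d}, {c, d}}"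
    using assms by (auto simp: nsets_2_eq)
  have co: "{a, b, c, d} - {a, b} = {c, d}" "{a, b, c, d} - {c, d} = {a, b}"
    "{a, b, c, d} - {a, c} = {b, d}" "{a, b, c, d} - {b, d} = {a, c}"
    "{a, b, c, d} - {a, d} = {b, c}" "{a, b, c, d} - {b, c} = {a, d}"
    using assms by auto
  have "pair_partitions {a, b, c, d} 2 = (\<lambda>p. {p, {a, b, c, d} - p}) ` nsets {a, b, c, d} 2"
    using pair_partitions_2_iff[OF X] by (intro Set.set_eqI) (simp add: image_iff)
  also have "\<dots> = {{{a, b}, {c, d}}, {{a, c}, {b, d}}, {{a, d}, {b, c}}}"
    unfolding ns image_insert image_empty co by (simp add: insert_commute)
  finally show ?thesis .
qed

lemma johnson_edge_4_2E:
  assumes "finite X" "card X = 4" "e \<in> johnson_edges X 2"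
  obtains a b c d where "distinct [a, b, c, d]" "X = {a, b, c, d}" "e = {{a, c}, {b, c}}"
    "\<Union> e - \<Inter> e = {a, b}" "X - {a, b} = {c, d}"
proof -
  obtain Y a b where *: "Y \<in> nsets X (2 - 1)" "a \<in> X - Y" "b \<in> X - Y" "a \<noteq> b"
    "e = {insert a Y, insert b Y}" "\<Union> e - \<Inter> e = {a, b}"
    using assms(3) by (elim johnson_edgeE) auto
  then obtain c where c: "Y = {c}" "c \<in> X"
    by (auto simp: nsets_def card_1_singleton_iff)
  have "card (X - {a, b, c}) = 1"
    using * c assms by (subst card_Diff_subset) auto
  then obtain d where "X - {a, b, c} = {d}"
    by (metis card_1_singletonE)
  then have d: "X = {a, b, c, d}" "d \<notin> {a, b, c}"
    using * c by auto
  show thesis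
  proof (rule that)
    show "distinct [a, b, c, d]"
      using * c d by auto
    then show "X - {a, b} = {c, d}"
      unfolding d(1) by auto
  qed (use * c d in simp_all)
qed

text \<open>For the edge with vertices {a, c} and {b, c}, the pairing ac|bd contains the first
  vertex and ad|bc the second. Only ab|cd avoids both, and it consists of the ends and their
  complement.\<close>

lemma four_cycle_iff:
  assumes "finite X" "card X = 4" "\<pi> \<in> pair_partitions X 2" "f \<in> johnson_edges X 2"
  shows "f \<subseteq> nsets X 2 - \<pi> \<longleftrightarrow> {\<Union> f - \<Inter> f, X - (\<Union> f - \<Inter> f)} = \<pi>"
proof -
  obtain a b c d where *: "distinct [a, b, c, d]" "X = {a, b, c, d}" "f = {{a, c}, {b, c}}"
    "\<Union> f - \<Inter> f = {a, b}" "X - {a, b} = {c, d}"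
    using johnson_edge_4_2E[OF assms(1,2,4)] by blast
  have "f \<subseteq> nsets X 2"
    using assms(4) by (auto simp: johnson_edges_def)
  then have "f \<subseteq> nsets X 2 - \<pi> \<longleftrightarrow> {a, c} \<notin> \<pi> \<and> {b, c} \<notin> \<pi>"
    using *(3) by auto
  moreover have "\<pi> \<in> {{{a, b}, {c, d}}, {{a, c}, {b, d}}, {{a, d}, {b, c}}}"
    using assms(3) pair_partitions_of_4[OF *(1)] *(2) by simp
  moreover have ne: "{a, c} \<noteq> {a, b}" "{a, c} \<noteq> {c, d}" "{b, c} \<noteq> {a, b}" "{b, c} \<noteq> {c, d}"
    "{a, b} \<noteq> {a, c}" "{a, b} \<noteq> {b, d}" "{a, b} \<noteq> {a, d}" "{a, b} \<noteq> {b, c}"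
    using *(1) by (auto simp: doubleton_eq_iff)
  moreover have "{{a, b}, {c, d}} \<noteq> \<pi>" if "{a, b} \<notin> \<pi>"
    using that by blast
  ultimately show ?thesis
    unfolding *(4,5) by (elim insertE) simp_all
qed

lemma four_cycles_image:
  assumes "finite X" "card X = 4"
  shows "four_cycles X =
    (\<lambda>\<pi>. {f \<in> johnson_edges X 2. {\<Union> f - \<Inter> f, X - (\<Union> f - \<Inter> f)} = \<pi>}) ` pair_partitions X 2"
  unfolding four_cycles_def setcompr_eq_image Collect_mem_eq
  by (intro image_cong refl Collect_cong conj_cong four_cycle_iff[OF assms])

lemma pair_partitions_2_image:
  assumes "finite X" "card X = 4"
  shows "pair_partitions X 2 = (\<lambda>e. {\<Union> e - \<Inter> e, X - (\<Union> e - \<Inter> e)}) ` johnson_edges X 2"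
proof (intro equalityI subsetI)
  fix \<pi> assume \<pi>: "\<pi> \<in> pair_partitions X 2"
  obtain p where p: "p \<in> nsets X 2" "\<pi> = {p, X - p}"
    using pair_partitions_2_iff[OF assms, THEN iffD1, OF \<pi>] by blast
  then obtain a b where ab: "a \<in> X" "b \<in> X" "a \<noteq> b" "p = {a, b}"
    by (auto elim: nsets2_E)
  obtain e where "e \<in> johnson_edges X 2" "\<Union> e - \<Inter> e = {a, b}"
    by (rule johnson_edge_with_diff[OF assms(1) _ _ ab(1-3), of 2]) (use assms in auto)
  with p(2) ab(4) show "\<pi> \<in> (\<lambda>e. {\<Union> e - \<Inter> e, X - (\<Union> e - \<Inter> e)}) ` johnson_edges X 2"
    by (intro image_eqI[of _ _ e]) simp_all
next
  fix \<pi> assume "\<pi> \<in> (\<lambda>e. {\<Union> e - \<Inter> e, X - (\<Union> e - \<Inter> e)}) ` johnson_edges X 2"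
  then obtain e where e: "e \<in> johnson_edges X 2" "\<pi> = {\<Union> e - \<Inter> e, X - (\<Union> e - \<Inter> e)}"
    by blast
  obtain a b c d where *: "distinct [a, b, c, d]" "X = {a, b, c, d}"
    "\<Union> e - \<Inter> e = {a, b}" "X - {a, b} = {c, d}"
    by (rule johnson_edge_4_2E[OF assms e(1)])
  show "\<pi> \<in> pair_partitions X 2"
    unfolding e(2) *(3,4) using pair_partitions_of_4[OF *(1)] *(2) by simp
qed

lemma four_cycles_eq:
  assumes "finite X" "card X = 4"
  shows "four_cycles X = (\<lambda>e. {f \<in> johnson_edges X 2. {\<Union> f - \<Inter> f, X - (\<Union> f - \<Inter> f)}
    = {\<Union> e - \<Inter> e, X - (\<Union> e - \<Inter> e)}}) ` johnson_edges X 2"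
  unfolding four_cycles_image[OF assms] pair_partitions_2_image[OF assms] by (simp add: image_image)

text \<open>Each pairing arises from some edge, so its 4-cycle is non-empty and any edge in it
  recovers the pairing. Thus there are as many cycles as pairings of four points.\<close>

lemma card_four_cycles:
  assumes "finite X" "card X = 4"
  shows "card (four_cycles X) = 3"
proof -
  have "card (four_cycles X) = card (pair_partitions X 2)"
    unfolding four_cycles_image[OF assms]
  proof (intro card_image inj_onI)
    fix \<pi> \<rho> assume \<pi>: "\<pi> \<in> pair_partitions X 2"
      and eq: "{f \<in> johnson_edges X 2. {\<Union> f - \<Inter> f, X - (\<Union> f - \<Inter> f)} = \<pi>}
        = {f \<in> johnson_edges X 2. {\<Union> f - \<Inter> f, X - (\<Union> f - \<Inter> f)} = \<rho>}"
    from \<pi> obtain e where "e \<in> johnson_edges X 2" "\<pi> = {\<Union> e - \<Inter> e, X - (\<Union> e - \<Inter> e)}"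
      unfolding pair_partitions_2_image[OF assms] by blast
    then have "e \<in> {f \<in> johnson_edges X 2. {\<Union> f - \<Inter> f, X - (\<Union> f - \<Inter> f)} = \<pi>}"
      by simp
    then show "\<pi> = \<rho>"
      unfolding eq using \<open>\<pi> = _\<close> by simp
  qed
  also have "\<dots> = 3"
  proof -
    obtain xs where xs: "distinct xs" "set xs = X" "length xs = 4"
      using assms finite_distinct_list distinct_card by metis
    then obtain a b c d where "xs = [a, b, c, d]"
      by (auto simp: numeral_eq_Suc length_Suc_conv)
    with xs have abcd: "distinct [a, b, c, d]" "X = {a, b, c, d}"
      by auto
    show ?thesis
      unfolding abcd(2) pair_partitions_of_4[OF abcd(1)] using abcd(1)
      by (auto simp: doubleton_eq_iff card_insert_if)
  qed
  finally show ?thesis .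
qed

lemma graph_iso_four_cycle:
  assumes "finite X" "card X = 4" "D \<in> four_cycles X"
  shows "graph_iso D (cycle_edges 4)"
proof -
  obtain e where e: "e \<in> johnson_edges X 2"
    "D = {f \<in> johnson_edges X 2. {\<Union> f - \<Inter> f, X - (\<Union> f - \<Inter> f)} = {\<Union> e - \<Inter> e, X - (\<Union> e - \<Inter> e)}}"
    using assms(3) unfolding four_cycles_eq[OF assms(1,2)] by blast
  obtain a b c d where *: "distinct [a, b, c, d]" "X = {a, b, c, d}"
    "\<Union> e - \<Inter> e = {a, b}" "X - {a, b} = {c, d}"
    by (rule johnson_edge_4_2E[OF assms(1,2) e(1)])
  have co: "X - {a, b} = {c, d}" "X - {c, d} = {a, b}"
    using *(1) unfolding *(2) by auto
  have one: "nsets {x, y} (Suc 0) = {{x}, {y}}" for x y :: 'a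
    by (auto simp: nsets_def card_1_singleton_iff)
  have M: "M_part X 2 a b = {{{a, c}, {b, c}}, {{a, d}, {b, d}}}"
    "M_part X 2 c d = {{{c, a}, {d, a}}, {{c, b}, {d, b}}}"
    unfolding M_part_def co setcompr_eq_image Collect_mem_eq by (simp_all add: one)
  \<comment> \<open>The part is the union of two matchings, one for each pair of the pairing, and
    each has two edges.\<close>
  have "f \<in> D \<longleftrightarrow> f \<in> M_part X 2 a b \<union> M_part X 2 c d" for f
  proof -
    have "{S, X - S} = {{a, b}, {c, d}} \<longleftrightarrow> S = {a, b} \<or> S = {c, d}" for S
      using co by (metis doubleton_eq_iff)
    then have "f \<in> D \<longleftrightarrow> f \<in> johnson_edges X 2 \<and> (\<Union> f - \<Inter> f = {a, b} \<or> \<Union> f - \<Inter> f = {c, d})"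
      unfolding e(2) *(3,4) by simp
    moreover have "f \<in> M_part X 2 a b \<longleftrightarrow> f \<in> johnson_edges X 2 \<and> \<Union> f - \<Inter> f = {a, b}"
      using * by (intro M_part_iff) auto
    moreover have "f \<in> M_part X 2 c d \<longleftrightarrow> f \<in> johnson_edges X 2 \<and> \<Union> f - \<Inter> f = {c, d}"
      using * by (intro M_part_iff) auto
    ultimately show ?thesis
      unfolding Un_iff by argo
  qed
  then have "D = M_part X 2 a b \<union> M_part X 2 c d"
    by (intro Set.set_eqI)
  then have D: "D = {{{a, c}, {b, c}}, {{a, d}, {b, d}}} \<union> {{{c, a}, {d, a}}, {{c, b}, {d, b}}}"
    unfolding M .
  have C: "cycle_edges 4 = {{0, 1}, {1, 2}, {2, 3}, {3, 0}}"
  proof -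
    have "{i::nat. i < 4} = {0, 1, 2, 3}"
      by auto
    moreover have "(0 + 1) mod 4 = (1::nat)" "(1 + 1) mod 4 = (2::nat)" "(2 + 1) mod 4 = (3::nat)"
      "(3 + 1) mod 4 = (0::nat)"
      by simp_all
    ultimately show ?thesis
      unfolding cycle_edges_def setcompr_eq_image by (simp only: image_insert image_empty)
  qed
  have perm: "{p, q, r, s} = {p, r, s, q}" for p q r s :: "'a set set"
    by blast
  \<comment> \<open>The vertices in cyclic order: neighbours share \<open>c\<close>,
    \<open>b\<close>, \<open>d\<close> and \<open>a\<close> in turn.\<close>
  let ?g = "(!) [{a, c}, {b, c}, {b, d}, {a, d}]"
  show ?thesis
  proof (rule graph_isoI)
    have "\<Union> (cycle_edges 4) = {..<4}"
      unfolding C by auto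
    moreover have "distinct [{a, c}, {b, c}, {b, d}, {a, d}]"
      using *(1) by (auto simp add: doubleton_eq_iff)
    ultimately show "inj_on ?g (\<Union> (cycle_edges 4))"
      by (intro inj_on_nth) auto
    have "(`) ?g ` cycle_edges 4 = {{{a, c}, {b, c}}, {{b, c}, {b, d}}, {{b, d}, {a, d}}, {{a, d}, {a, c}}}"
      unfolding C by simp
    also have "\<dots> = {{{a, c}, {b, c}}, {{b, d}, {a, d}}, {{a, d}, {a, c}}, {{b, c}, {b, d}}}"
      by (rule perm)
    also have "\<dots> = {{{a, c}, {b, c}}, {{a, d}, {b, d}}, {{c, a}, {d, a}}, {{c, b}, {d, b}}}"
    proof -
      have "{{b, d}, {a, d}} = {{a, d}, {b, d}}" "{{a, d}, {a, c}} = {{c, a}, {d, a}}"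
        "{{b, c}, {b, d}} = {{c, b}, {d, b}}"
        by (simp_all only: insert_commute)
      then show ?thesis
        by (simp only:)
    qed
    also have "\<dots> = D"
      unfolding D by (simp only: Un_insert_left Un_empty_left)
    finally show "(`) ?g ` cycle_edges 4 = D" .
  qed
qed

lemma complement_pair_eq_iff:
  "{A, X - A} = {B, X - B} \<longleftrightarrow> A = B \<or> A = X - B" if "B \<subseteq> X"
  using that by (auto simp: doubleton_eq_iff)

lemma cells_disjoint: "disjoint {A, B - A, X - B}" if "A \<subseteq> B"
  using that by (auto simp: disjoint_def)

section \<open>Identification of the parts\<close>

context johnson_decomposition
begin

lemma card_X_ge: "k + 1 \<le> card X"
  using k_ge card_X by simp

text \<open>The complement of the common points is the class containing both ends. No exception
  arises here: k - 1 is less than half of |X|, so the common points of one edge are never the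
  complement of those of another.\<close>

lemma parts_if_Inter:
  assumes "\<And>D e f. D \<in> P \<Longrightarrow> e \<in> D \<Longrightarrow> f \<in> D \<Longrightarrow> {\<Inter> e, X - \<Inter> e} = {\<Inter> f, X - \<Inter> f}"
  shows "P = P_cap X k"
proof -
  let ?F = "\<lambda>e. {\<Inter> e, X - \<Inter> e}"
  have "P = (\<lambda>e. {f \<in> johnson_edges X k. ?F f = ?F e}) ` johnson_edges X k"
  proof (rule parts_eq_fibres)
    fix g e assume "g permutes X"
    then show "?F (act g e) = (`) g ` ?F e"
      by (simp add: Inter_act permutes_bij image_set_diff permutes_inj permutes_image)
  next
    fix e assume e: "e \<in> johnson_edges X k"
    note c = johnson_edge_cards[OF e k_ge_1 finite_X]
    show "disjoint (?F e)"
      by (auto simp: disjoint_def)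
    have "\<Inter> e \<noteq> {}"
      using c(3) k_ge by (metis card.empty diff_is_0_eq not_numeral_le_zero Suc_1 not_less_eq_eq One_nat_def)
    then have "\<Union> e - \<Inter> e \<subseteq> X - \<Inter> e \<and> X - \<Inter> e \<subset> X"
      using c(1,2) by (metis Diff_mono Diff_subset double_diff psubsetI order_refl Diff_cancel order_trans)
    then show "\<exists>C\<in>?F e. \<Union> e - \<Inter> e \<subseteq> C \<and> C \<subset> X"
      by (intro bexI[of _ "X - \<Inter> e"]) simp_all
  qed (fact assms)
  also have "\<dots> = P_cap X k"
    unfolding P_cap_eq[OF finite_X k_ge_1 card_X_ge]
  proof (intro image_cong refl Collect_cong conj_cong)
    fix e f assume e: "e \<in> johnson_edges X k" and f: "f \<in> johnson_edges X k"
    have "card (\<Inter> f) \<noteq> card (X - \<Inter> e)"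
      using johnson_edge_cards(3)[OF f k_ge_1 finite_X] johnson_edge_cards(7)[OF e k_ge_1 finite_X]
        k_ge card_X by linarith
    then show "?F f = ?F e \<longleftrightarrow> \<Inter> f = \<Inter> e"
      by (metis doubleton_eq_iff)
  qed
  finally show ?thesis .
qed

text \<open>The unions of two edges can be complementary only if |X| - (k + 1) = k + 1. In that case
  the unordered pair cannot tell them apart, and two parts of \<open>P_cup\<close> fuse.\<close>

lemma parts_if_Union:
  assumes "\<And>D e f. D \<in> P \<Longrightarrow> e \<in> D \<Longrightarrow> f \<in> D \<Longrightarrow> {\<Union> e, X - \<Union> e} = {\<Union> f, X - \<Union> f}"
  shows "P = P_cup X k \<and> card X \<noteq> 2 * k + 2 \<or> card X = 2 * k + 2 \<and> P = Q_pairs X k"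
proof -
  let ?F = "\<lambda>e. {\<Union> e, X - \<Union> e}"
  have P: "P = (\<lambda>e. {f \<in> johnson_edges X k. ?F f = ?F e}) ` johnson_edges X k"
  proof (rule parts_eq_fibres)
    fix g e assume "g permutes X"
    then show "?F (act g e) = (`) g ` ?F e"
      by (simp add: Union_act image_set_diff permutes_inj permutes_image)
  next
    fix e assume e: "e \<in> johnson_edges X k"
    note c = johnson_edge_cards[OF e k_ge_1 finite_X]
    show "disjoint (?F e)"
      by (auto simp: disjoint_def)
    have "card (\<Union> e) < card X"
      using c(4) k_ge card_X by simp
    then have "\<Union> e \<noteq> X"
      by auto
    then show "\<exists>C\<in>?F e. \<Union> e - \<Inter> e \<subseteq> C \<and> C \<subset> X"
      using c(2) by (intro bexI[of _ "\<Union> e"] conjI psubsetI) simp_all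
  qed (fact assms)
  show ?thesis
  proof (cases "card X = 2 * k + 2")
    case True
    have "P = Q_pairs X k"
      unfolding Q_pairs_eq[OF finite_X k_ge_1 card_X_ge True] P
    proof (intro image_cong refl Collect_cong conj_cong)
      fix e f assume e: "e \<in> johnson_edges X k" and f: "f \<in> johnson_edges X k"
      show "?F f = ?F e \<longleftrightarrow> \<Union> f = \<Union> e \<or> \<Union> f = X - \<Union> e"
        by (rule complement_pair_eq_iff[OF johnson_edge_cards(2)[OF e k_ge_1 finite_X]])
    qed
    then show ?thesis
      using True by blast
  next
    case False
    have "P = P_cup X k"
      unfolding P_cup_eq[OF finite_X k_ge_1 card_X_ge] P
    proof (intro image_cong refl Collect_cong conj_cong)
      fix e f assume e: "e \<in> johnson_edges X k" and f: "f \<in> johnson_edges X k"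
      have "card (\<Union> f) \<noteq> card (X - \<Union> e)"
        using johnson_edge_cards(4)[OF f k_ge_1 finite_X] johnson_edge_cards(6)[OF e k_ge_1 finite_X]
          False by linarith
      then show "?F f = ?F e \<longleftrightarrow> \<Union> f = \<Union> e"
        by (metis doubleton_eq_iff)
    qed
    then show ?thesis
      using False by blast
  qed
qed

text \<open>The end pairs of two edges can be complementary only if |X| - 2 = 2, and then the bounds
  on \<open>k\<close> force \<open>k = 2\<close>.\<close>

lemma parts_if_diff:
  assumes "\<And>D e f. D \<in> P \<Longrightarrow> e \<in> D \<Longrightarrow> f \<in> D \<Longrightarrow>
    {\<Union> e - \<Inter> e, X - (\<Union> e - \<Inter> e)} = {\<Union> f - \<Inter> f, X - (\<Union> f - \<Inter> f)}"
  shows "P = P_ominus X k \<and> card X \<noteq> 4 \<or> card X = 4 \<and> k = 2 \<and> P = four_cycles X"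
proof -
  let ?F = "\<lambda>e. {\<Union> e - \<Inter> e, X - (\<Union> e - \<Inter> e)}"
  have P: "P = (\<lambda>e. {f \<in> johnson_edges X k. ?F f = ?F e}) ` johnson_edges X k"
  proof (rule parts_eq_fibres)
    fix g e assume "g permutes X"
    then show "?F (act g e) = (`) g ` ?F e"
      by (simp add: Union_act Inter_act permutes_bij image_set_diff permutes_inj permutes_image)
  next
    fix e assume e: "e \<in> johnson_edges X k"
    note c = johnson_edge_cards[OF e k_ge_1 finite_X]
    show "disjoint (?F e)"
      by (auto simp: disjoint_def)
    have "\<Union> e - \<Inter> e \<noteq> X"
      using c(5) card_X k_ge by auto
    then have "\<Union> e - \<Inter> e \<subset> X"
      using c(2) by (intro psubsetI) (rule order_trans[OF Diff_subset])
    then show "\<exists>C\<in>?F e. \<Union> e - \<Inter> e \<subseteq> C \<and> C \<subset> X"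
      by (intro bexI[of _ "\<Union> e - \<Inter> e"]) simp_all
  qed (fact assms)
  show ?thesis
  proof (cases "card X = 4")
    case True
    then have "k = 2"
      using k_ge card_X by simp
    then show ?thesis
      using P four_cycles_eq[OF finite_X True] True by simp
  next
    case False
    have "P = P_ominus X k"
      unfolding P_ominus_eq[OF finite_X k_ge_1 card_X_ge] P
    proof (intro image_cong refl Collect_cong conj_cong)
      fix e f assume e: "e \<in> johnson_edges X k" and f: "f \<in> johnson_edges X k"
      have "card (\<Union> f - \<Inter> f) \<noteq> card (X - (\<Union> e - \<Inter> e))"
        using johnson_edge_cards(5)[OF f k_ge_1 finite_X] johnson_edge_cards(8)[OF e k_ge_1 finite_X]
          False by linarith
      then show "?F f = ?F e \<longleftrightarrow> \<Union> f - \<Inter> f = \<Union> e - \<Inter> e"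
        by (metis doubleton_eq_iff)
    qed
    then show ?thesis
      using False by blast
  qed
qed

text \<open>When all cells have size 2 they can exchange roles within a part, and only the unordered
  set of cells is an invariant.\<close>

lemma parts_if_cells:
  assumes "\<And>D e f. D \<in> P \<Longrightarrow> e \<in> D \<Longrightarrow> f \<in> D \<Longrightarrow>
    {\<Inter> e, \<Union> e - \<Inter> e, X - \<Union> e} = {\<Inter> f, \<Union> f - \<Inter> f, X - \<Union> f}"
    and "k = 3" "card X = 6"
  shows "P = pi_parts X"
proof -
  let ?F = "\<lambda>e. {\<Inter> e, \<Union> e - \<Inter> e, X - \<Union> e}"
  have "P = (\<lambda>e. {f \<in> johnson_edges X k. ?F f = ?F e}) ` johnson_edges X k"
  proof (rule parts_eq_fibres)
    fix g e assume "g permutes X"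
    then show "?F (act g e) = (`) g ` ?F e"
      by (simp add: Union_act Inter_act permutes_bij image_set_diff permutes_inj permutes_image)
  next
    fix e assume e: "e \<in> johnson_edges X k"
    note c = johnson_edge_cards[OF e k_ge_1 finite_X]
    show "disjoint (?F e)"
      using cells_disjoint[OF c(1)] .
    have "\<Union> e - \<Inter> e \<noteq> X"
      using c(5) card_X k_ge by auto
    then have "\<Union> e - \<Inter> e \<subset> X"
      using c(2) by (intro psubsetI) (rule order_trans[OF Diff_subset])
    then show "\<exists>C\<in>?F e. \<Union> e - \<Inter> e \<subseteq> C \<and> C \<subset> X"
      by (intro bexI[of _ "\<Union> e - \<Inter> e"]) simp_all
  qed (fact assms(1))
  then show ?thesis
    unfolding assms(2) pi_parts_eq[OF finite_X assms(3)] .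
qed

lemma parts_cases:
  "P = P_cap X k \<or>
   P = P_cup X k \<and> card X \<noteq> 2 * k + 2 \<or>
   card X = 2 * k + 2 \<and> P = Q_pairs X k \<or>
   P = P_ominus X k \<and> card X \<noteq> 4 \<or>
   card X = 4 \<and> k = 2 \<and> P = four_cycles X \<or>
   card X = 6 \<and> k = 3 \<and> P = pi_parts X"
proof (cases rule: swap_classes_cases)
  case Common
  then show ?thesis
    using parts_if_Inter by metis
next
  case Span
  then show ?thesis
    using parts_if_Union by metis
next
  case Ends
  then show ?thesis
    using parts_if_diff by metis
next
  case Cells
  have eq: "{\<Inter> e, \<Union> e - \<Inter> e, X - \<Union> e} = {\<Inter> f, \<Union> f - \<Inter> f, X - \<Union> f}"
    if "D \<in> P" "e \<in> D" "f \<in> D" for D e f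
    using Cells[OF that(1,2)] Cells[OF that(1,3)] by simp
  have cards: "card (\<Inter> e) = k - 1" "card (\<Union> e - \<Inter> e) = 2" "card (X - \<Union> e) = card X - (k + 1)"
    if "D \<in> P" "e \<in> D" for D e
    using johnson_edge_cards(3,5,6)[OF edge_if_in_part[OF that] k_ge_1 finite_X] .
  \<comment> \<open>The sizes k - 1 and 2 agree iff k = 3; k - 1 and |X| - (k + 1) agree iff |X| =
    2k. So the cell of unique size is the common one, the outside one and the pair of ends in the
    first three cases; in the last case all sizes are 2. The first three cases are not refuted: a
    cell constant on parts already identifies \<open>P\<close> by the lemmas for two
    classes.\<close>
  consider "k \<noteq> 3" "card X \<noteq> 2 * k" | "k = 3" "card X \<noteq> 6" | "k \<noteq> 3" "card X = 2 * k"
    | "k = 3" "card X = 6"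
    by blast
  then show ?thesis
  proof cases
    case 1
    have *: "\<Inter> e = \<Inter> f" if "D \<in> P" "e \<in> D" "f \<in> D" for D e f
    proof -
      have "\<Inter> e \<in> {\<Inter> f, \<Union> f - \<Inter> f, X - \<Union> f}"
        unfolding eq[OF that, symmetric] by simp
      moreover have "card (\<Inter> e) \<noteq> card (\<Union> f - \<Inter> f)" "card (\<Inter> e) \<noteq> card (X - \<Union> f)"
        using cards[OF that(1,2)] cards[OF that(1,3)] 1 k_ge card_X by auto
      ultimately show ?thesis
        unfolding insert_iff by (metis emptyE)
    qed
    have "P = P_cap X k"
      \<comment> \<open>Equality of the cells is lifted to equality of the pairs {A, X - A}, the
        form of the hypothesis.\<close>
      by (rule parts_if_Inter) (rule arg_cong[OF *, of _ _ _ "\<lambda>A. {A, X - A}"])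
    then show ?thesis
      by blast
  next
    case 2
    have *: "\<Union> e = \<Union> f" if "D \<in> P" "e \<in> D" "f \<in> D" for D e f
    proof -
      have "X - \<Union> e \<in> {\<Inter> f, \<Union> f - \<Inter> f, X - \<Union> f}"
        unfolding eq[OF that, symmetric] by simp
      moreover have "card (X - \<Union> e) \<noteq> card (\<Union> f - \<Inter> f)" "card (X - \<Union> e) \<noteq> card (\<Inter> f)"
        using cards[OF that(1,2)] cards[OF that(1,3)] 2 k_ge card_X by auto
      ultimately have "X - \<Union> e = X - \<Union> f"
        unfolding insert_iff by (metis emptyE)
      then show ?thesis
        using johnson_edge_cards(2)[OF edge_if_in_part[OF that(1,2)] k_ge_1 finite_X]
          johnson_edge_cards(2)[OF edge_if_in_part[OF that(1,3)] k_ge_1 finite_X]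
        by (metis double_diff order_refl)
    qed
    have "P = P_cup X k \<and> card X \<noteq> 2 * k + 2 \<or> card X = 2 * k + 2 \<and> P = Q_pairs X k"
      by (rule parts_if_Union) (rule arg_cong[OF *, of _ _ _ "\<lambda>A. {A, X - A}"])
    then show ?thesis
      by blast
  next
    case 3
    have *: "\<Union> e - \<Inter> e = \<Union> f - \<Inter> f" if "D \<in> P" "e \<in> D" "f \<in> D" for D e f
    proof -
      have "\<Union> e - \<Inter> e \<in> {\<Inter> f, \<Union> f - \<Inter> f, X - \<Union> f}"
        unfolding eq[OF that, symmetric] by simp
      moreover have "card (\<Union> e - \<Inter> e) \<noteq> card (\<Inter> f)" "card (\<Union> e - \<Inter> e) \<noteq> card (X - \<Union> f)"
        using cards[OF that(1,2)] cards[OF that(1,3)] 3 k_ge card_X by auto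
      ultimately show ?thesis
        unfolding insert_iff by (metis emptyE)
    qed
    have "P = P_ominus X k \<and> card X \<noteq> 4 \<or> card X = 4 \<and> k = 2 \<and> P = four_cycles X"
      by (rule parts_if_diff) (rule arg_cong[OF *, of _ _ _ "\<lambda>A. {A, X - A}"])
    then show ?thesis
      by blast
  next
    case 4
    then have "P = pi_parts X"
      by (intro parts_if_cells eq)
    then show ?thesis
      using 4 by blast
  qed
qed

end

theorem theorem4p2:
  fixes X :: "'a set" and n k :: nat and P :: "'a set set set set"
  assumes "finite X" and "card X = n"
    and "2 \<le> k" and "n \<ge> 2 * k"
    and "Sym_primitive_decomposition X k P"
  shows "P = P_cap X k
    \<or> (P = P_cup X k \<and> n \<noteq> 2 * k + 2)
    \<or> (P = P_ominus X k \<and> (n, k) \<noteq> (4, 2))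
    \<or> (n = 2 * k + 2 \<and> P = Q_pairs X k
        \<and> (\<forall>D \<in> P. graph_iso D (copies_complete 2 (k + 1))))
    \<or> ((n, k) = (4, 2) \<and> P = four_cycles X \<and> card P = 3
        \<and> (\<forall>D \<in> P. graph_iso D (cycle_edges 4)))
    \<or> ((n, k) = (6, 3) \<and> P = pi_parts X
        \<and> (\<forall>D \<in> P. graph_iso D (copies_complete 6 2)))"
proof -
  interpret johnson_decomposition X k P
    using assms by (intro Sym_primitive_decomposition_imp) simp_all
  have "graph_iso D (copies_complete 2 (k + 1))" if "n = 2 * k + 2" "D \<in> Q_pairs X k" for D
    using that graph_iso_Q_pair[OF assms(1) _ k_ge_1] assms(2) by (auto simp: Q_pairs_def)
  moreover have "graph_iso D (cycle_edges 4)" if "n = 4" "D \<in> four_cycles X" for D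
    using that graph_iso_four_cycle assms(1,2) by blast
  moreover have "card (four_cycles X) = 3" if "n = 4"
    using that card_four_cycles assms(1,2) by blast
  moreover have "graph_iso D (copies_complete 6 2)" if "n = 6" "D \<in> pi_parts X" for D
    using that graph_iso_pi_part[OF assms(1)] assms(2) by (auto simp: pi_parts_def)
  ultimately show ?thesis
    using parts_cases unfolding assms(2) by (elim disjE) simp_all
qed

end
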